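(* Let $F\subseteq\mathbb{R}^d$ be non-empty and bounded, and let $s\in[\dim_{\mathrm L}F,\dim_{\mathrm{qL}}F]$. Then there exists a dimension function $\phi:(0,1)\to[0,d]$ such that $$\dim_{\mathrm L}^{\phi}F=\underline{\dim}_{\mathrm L}^{\phi}F=s.$$
   Context: $B(x,R)$ is the ball of centre $x$ and radius $R$, and $N_r(E)$ is the smallest number of balls of radius $r$ needed to cover $E$. A dimension function is a positive function $\phi$ on $(0,1)$ such that $\phi(R)$ decreases as $R\to0$, and $\phi(R)\log(1/R)$ increases to infinity as $R$ decreases to $0$ (monotonicity in the non-strict sense, so constant functions are allowed). The lower Assouad dimension of $F$ is $$\dim_{\mathrm L}F=\sup\Big\{s\ge0:\ \exists\,C>0 \text{ such that } \forall\, 0<r<R<1,\ \forall x\in F,\ N_r(B(x,R)\cap F)\ge C\,(R/r)^{s}\Big\}.$$ For $\theta\in(0,1)$ the lower Assouad spectrum $\dim_{\mathrm L}^{\theta}F$ is obtained by restricting to $r=R^{1/\theta}$: $$\dim_{\mathrm L}^{\theta}F=\sup\Big\{s\ge0:\ \exists\,C>0 \text{ such that } \forall\, 0<R<1,\ \forall x\in F,\ N_{R^{1/\theta}}(B(x,R)\cap F)\ge C\,(R/R^{1/\theta})^{s}\Big\},$$ and the quasi-lower Assouad dimension is $\dim_{\mathrm{qL}}F=\lim_{\theta\to1^-}\dim_{\mathrm L}^{\theta}F$ (this limit exists). The $\phi$-lower dimension of $F$ is $$\dim_{\mathrm L}^{\phi}F=\sup\Big\{s\ge0:\ \exists\,C>0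 \text{ such that } \forall\, 0<R<1,\ \inf_{x\in F}N_{R^{1+\phi(R)}}(B(x,R)\cap F)\ge C\,R^{-\phi(R)s}\Big\}.$$ The quasi $\phi$-lower dimension of $F$ is $$\underline{\dim}_{\mathrm L}^{\phi}F=\sup\Big\{s\ge0:\ \exists\,C>0 \text{ such that } \forall\, 0<r\le R^{1+\phi(R)}<R<1,\ \inf_{x\in F}N_{r}(B(x,R)\cap F)\ge C\,(R/r)^{s}\Big\}.$$ *)

theory Defs
  imports "HOL-Analysis.Analysis"
begin

text \<open>
  Balls are open and the centres of covering balls range over the whole ambient space.
  The set below is non-empty whenever \<open>E\<close> is totally bounded and \<open>r > 0\<close>, which is the only
  case that occurs in what follows.
\<close>

definition covering_number :: "real \<Rightarrow> 'a::metric_space set \<Rightarrow> nat" where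
  "covering_number r E = Inf {card A |A. finite A \<and> E \<subseteq> (\<Union>a\<in>A. ball a r)}"

definition dimension_function :: "(real \<Rightarrow> real) \<Rightarrow> bool" where
  "dimension_function \<phi> \<longleftrightarrow>
     (\<forall>R\<in>{0<..<1}. \<phi> R > 0) \<and>
     mono_on {0<..<1} \<phi> \<and>
     antimono_on {0<..<1} (\<lambda>R. \<phi> R * ln (1 / R)) \<and>
     filterlim (\<lambda>R. \<phi> R * ln (1 / R)) at_top (at_right 0)"

text \<open>
  Dimensions are extended reals, so that the suprema are meaningful even for sets of exponents
  that are not known to be bounded.
\<close>

definition lower_dim :: "'a::metric_space set \<Rightarrow> ereal" where
  "lower_dim F = Sup (ereal ` {s. s \<ge> 0 \<and> (\<exists>C>0. \<forall>r R. 0 < r \<and> r < R \<and> R < 1 \<longrightarrow>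
     (\<forall>x\<in>F. real (covering_number r (ball x R \<inter> F)) \<ge> C * (R / r) powr s))})"

definition lower_spectrum :: "'a::metric_space set \<Rightarrow> real \<Rightarrow> ereal" where
  "lower_spectrum F \<theta> = Sup (ereal ` {s. s \<ge> 0 \<and> (\<exists>C>0. \<forall>R. 0 < R \<and> R < 1 \<longrightarrow>
     (\<forall>x\<in>F. real (covering_number (R powr (1 / \<theta>)) (ball x R \<inter> F))
             \<ge> C * (R / R powr (1 / \<theta>)) powr s))})"

definition quasi_lower_dim :: "'a::metric_space set \<Rightarrow> ereal" where
  "quasi_lower_dim F = Lim (at_left 1) (lower_spectrum F)"

definition phi_lower_dim :: "(real \<Rightarrow> real) \<Rightarrow> 'a::metric_space set \<Rightarrow> ereal" where
  "phi_lower_dim \<phi> F = Sup (ereal ` {s. s \<ge> 0 \<and> (\<exists>C>0. \<forall>R. 0 < R \<and> R < 1 \<longrightarrow>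
     (INF x\<in>F. real (covering_number (R powr (1 + \<phi> R)) (ball x R \<inter> F)))
       \<ge> C * R powr (- (\<phi> R * s)))})"

definition quasi_phi_lower_dim :: "(real \<Rightarrow> real) \<Rightarrow> 'a::metric_space set \<Rightarrow> ereal" where
  "quasi_phi_lower_dim \<phi> F = Sup (ereal ` {s. s \<ge> 0 \<and> (\<exists>C>0. \<forall>r R.
     0 < r \<and> r \<le> R powr (1 + \<phi> R) \<and> R powr (1 + \<phi> R) < R \<and> R < 1 \<longrightarrow>
     (INF x\<in>F. real (covering_number r (ball x R \<inter> F))) \<ge> C * (R / r) powr s)})"

end

theory Submission
  imports Defs
begin

text \<open>
In logarithmic coordinates \<open>R = exp (- t)\<close>, \<open>r = exp (- (t + u))\<close> let \<open>g t u\<close> be the logarithm of the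
least number, over centres \<open>x\<close> in \<open>F\<close>, of \<open>r\<close>-balls needed to cover \<open>ball x R \<inter> F\<close>, and replace \<open>\<phi>\<close> by
\<open>\<psi> t = t * \<phi> (exp (- t))\<close>. Apart from the quasi-lower dimension, which is a limit, every dimension in
question is then the supremum of the slopes \<open>a\<close> for which \<open>g t u \<ge> a * u - c\<close> holds on a region: all
\<open>u > 0\<close> for the lower dimension, \<open>u = (1 / \<theta> - 1) * t\<close> for the spectrum, \<open>u = \<psi> t\<close> for the \<open>\<phi>\<close>-lower
dimension and \<open>u \<ge> \<psi> t\<close> for its quasi version. All that is needed about \<open>g\<close> is collected in the
locale \<open>scale_profile\<close>; its main property is that covering bounds at consecutive scales multiply.

This property turns slopes along arbitrarily short steps into slopes at all far scales
\<open>u \<ge> \<epsilon> * t\<close> (\<open>far_exponent_if_short_steps\<close>). It follows that the limit of the spectrum exists and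
equals its infimum, and that the bound \<open>g t u \<ge> a * u\<close> holds at far scales for every \<open>a\<close> below the
quasi-lower dimension.

It remains to find \<open>\<psi>\<close>, subject to the conditions that \<open>\<psi> t\<close> does not decrease, that \<open>\<psi> t / t\<close> does not
increase, that \<open>\<psi> t \<le> t\<close>, and that \<open>\<psi>\<close> tends to infinity. If \<open>s\<close> is below the quasi-lower dimension, \<open>\<psi>\<close> is the least
such function above all points \<open>(t, u)\<close> with \<open>u \<le> t\<close> at which \<open>g t u < s * u\<close>, together with a sequence of points
whose slopes tend to \<open>s\<close>, which exists because \<open>s\<close> is not below the lower dimension. Beyond \<open>\<psi>\<close> the
slope is at least \<open>s\<close>, up to an additive constant. A point that nearly determines the value of \<open>\<psi>\<close> somewhere lies nearly on the graph
of \<open>\<psi>\<close>, so that the slope along the graph is not better than \<open>s\<close>. If \<open>s\<close> is the quasi-lower dimension,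
\<open>\<psi>\<close> is chosen such that \<open>\<psi> t / t\<close> tends to \<open>0\<close>, but slowly enough for the slopes below \<open>s\<close> to hold beyond
\<open>\<psi>\<close>; slopes above \<open>s\<close> along the graph are excluded, as they would be slopes along short steps.
\<close>

section \<open>Exponents of functions of two scales\<close>

text \<open>
In the coordinates \<open>R = exp (- t)\<close>, \<open>r = exp (- (t + u))\<close> a lower dimension asks for a linear
lower bound in \<open>u\<close> for a function \<open>g t u\<close>, up to an additive constant, on some region of pairs
\<open>(t, u)\<close>. The following predicates differ only in that region.
\<close>

definition lower_exponent :: "(real \<Rightarrow> real \<Rightarrow> real) \<Rightarrow> real \<Rightarrow> bool" where
  "lower_exponent g a \<longleftrightarrow> (\<exists>c. \<forall>t>0. \<forall>u>0. a * u - c \<le> g t u)"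

definition phi_exponent :: "(real \<Rightarrow> real \<Rightarrow> real) \<Rightarrow> (real \<Rightarrow> real) \<Rightarrow> real \<Rightarrow> bool" where
  "phi_exponent g \<psi> a \<longleftrightarrow> (\<exists>c. \<forall>t>0. a * \<psi> t - c \<le> g t (\<psi> t))"

definition quasi_exponent :: "(real \<Rightarrow> real \<Rightarrow> real) \<Rightarrow> (real \<Rightarrow> real) \<Rightarrow> real \<Rightarrow> bool" where
  "quasi_exponent g \<psi> a \<longleftrightarrow> (\<exists>c. \<forall>t>0. \<forall>u\<ge>\<psi> t. a * u - c \<le> g t u)"

text \<open>
These slopes describe the quasi-lower Assouad dimension. The region \<open>u \<ge> \<epsilon> t\<close> is that of
\<open>r \<le> R powr (1 + \<epsilon>)\<close>. The bound carries no additive constant, since for large \<open>u\<close> a constant is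
absorbed by lowering the slope slightly.
\<close>

definition far_exponent :: "(real \<Rightarrow> real \<Rightarrow> real) \<Rightarrow> real \<Rightarrow> bool" where
  "far_exponent g a \<longleftrightarrow>
     (\<forall>\<epsilon>>0. \<exists>C. \<forall>t>0. \<forall>u. \<epsilon> * t \<le> u \<longrightarrow> C \<le> u \<longrightarrow> a * u \<le> g t u)"

text \<open>
The functions \<open>\<psi> t = t * \<phi> (exp (- t))\<close> that come from dimension functions \<open>\<phi>\<close> with values in
\<open>(0, 1]\<close>. The inequality between products says that \<open>\<psi> t / t\<close> does not increase.
\<close>

definition admissible :: "(real \<Rightarrow> real) \<Rightarrow> bool" where
  "admissible \<psi> \<longleftrightarrow>
     (\<forall>t>0. 0 < \<psi> t \<and> \<psi> t \<le> t) \<and>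
     (\<forall>t>0. \<forall>t'\<ge>t. \<psi> t \<le> \<psi> t' \<and> t * \<psi> t' \<le> t' * \<psi> t) \<and>
     filterlim \<psi> at_top at_top"

section \<open>Scale profiles and far exponents\<close>

text \<open>
What the construction uses about covering numbers. Gluing is supermultiplicativity: a ball contains
separated smaller balls, each of which needs its own cover. Since the smaller balls must not stick
out of the big one, their centres range over a concentric ball of half the radius, whence the shift
\<open>L\<close> in the first argument. This shift cannot be traded for a constant: nothing bounds \<open>g t u\<close> from
above by values of \<open>g\<close> at larger \<open>t\<close>, because a smaller ball may see far less of the set.
\<close>

locale scale_profile =
  fixes g :: "real \<Rightarrow> real \<Rightarrow> real" and L K D :: real
  assumes L_nonneg: "0 \<le> L" and K_nonneg: "0 \<le> K" and D_nonneg: "0 \<le> D"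
    and nonneg: "0 < t \<Longrightarrow> 0 \<le> u \<Longrightarrow> 0 \<le> g t u"
    and shift: "0 < t \<Longrightarrow> 0 \<le> h \<Longrightarrow> h \<le> u \<Longrightarrow> g (t + h) (u - h) \<le> g t u"
    and glue: "0 < t \<Longrightarrow> 0 \<le> v \<Longrightarrow> 0 \<le> w \<Longrightarrow>
      g (t + L) v + g (t + L + v) w - K \<le> g t (L + v + w)"
    and growth: "0 < t \<Longrightarrow> 0 \<le> u \<Longrightarrow> 0 \<le> h \<Longrightarrow> g t (u + h) \<le> g t u + D * h + K"
begin

lemma far_exponent_nonpos:
  assumes "a \<le> 0"
  shows "far_exponent g a"
  unfolding far_exponent_def
proof (intro allI impI exI[of _ 0])
  fix \<epsilon> t u :: real
  assume "0 < t" "0 \<le> u"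
  then have "0 \<le> g t u" by (rule nonneg)
  moreover have "a * u \<le> 0" using assms \<open>0 \<le> u\<close> by (rule mult_nonpos_nonneg)
  ultimately show "a * u \<le> g t u" by linarith
qed

text \<open>
From \<open>t\<close>, walk to \<open>t + u\<close> in steps \<open>L + v\<close>, where \<open>v\<close> is a step provided by the hypothesis. Each
step gains at least \<open>a' * v\<close> and gluing costs \<open>K\<close>, which long steps absorb into a smaller slope \<open>b\<close>.
All steps are short compared with the current scale, so that the part of \<open>[t, t + u]\<close> left uncovered
by the last complete step is a small fraction of \<open>t + u\<close>; for \<open>u \<ge> \<epsilon>0 * t\<close> this is a small fraction
of \<open>u\<close>, and a second reduction of the slope, from \<open>b\<close> to \<open>a\<close>, pays for it.
\<close>

lemma far_exponent_if_short_steps: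
  assumes less: "a < a'"
    and steps: "\<And>\<epsilon> V. 0 < \<epsilon> \<Longrightarrow>
      \<exists>T. \<forall>t\<ge>T. \<exists>v. V \<le> v \<and> v \<le> \<epsilon> * t \<and> a' * v \<le> g t v"
  shows "far_exponent g a"
proof (cases "a \<le> 0")
  case True
  then show ?thesis by (rule far_exponent_nonpos)
next
  case False
  define b where "b = (a + a') / 2"
  have ab: "0 < a" "a < b" "b < a'" "0 < b" using False less by (auto simp: b_def)
  show ?thesis
    unfolding far_exponent_def
  proof (intro allI impI)
    fix \<epsilon>0 :: real
    assume \<epsilon>0: "0 < \<epsilon>0"
    \<comment> \<open>The relative step length is chosen so that half of \<open>b - a\<close> remains as slack below.\<close>
    define \<epsilon> where "\<epsilon> = (b - a) / (2 * (a + b / \<epsilon>0))"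
    have pos: "0 < a + b / \<epsilon>0" using ab \<epsilon>0 by (simp add: add_pos_pos)
    have \<epsilon>: "0 < \<epsilon>" using ab pos by (simp add: \<epsilon>_def)
    have slack: "b * (1 - \<epsilon> / \<epsilon>0) - a * (1 + \<epsilon>) = (b - a) / 2"
    proof -
      have "\<epsilon> * (a + b / \<epsilon>0) = (b - a) / 2"
        unfolding \<epsilon>_def using pos by (metis nonzero_divide_eq_eq divide_divide_eq_left less_irrefl)
      then show ?thesis by (simp add: algebra_simps)
    qed
    define V where "V = max 1 ((K + b * L) / (a' - b))"
    obtain T0 where T0: "\<And>t. T0 \<le> t \<Longrightarrow> \<exists>v. V \<le> v \<and> v \<le> \<epsilon> / 2 * t \<and> a' * v \<le> g t v"
      using steps[of "\<epsilon> / 2" V] \<epsilon> by auto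
    define T where "T = Max {1, T0, L + 2 * L / \<epsilon>}"
    have T: "1 \<le> T" "T0 \<le> T" "L + 2 * L / \<epsilon> \<le> T" by (auto simp: T_def)
    have step: "\<exists>v\<ge>1. L + v \<le> \<epsilon> * t \<and> b * (L + v) + K \<le> g (t + L) v" if t: "T \<le> t" for t
    proof -
      have "T0 \<le> t + L" using t T L_nonneg by linarith
      then obtain v where v: "V \<le> v" "v \<le> \<epsilon> / 2 * (t + L)" "a' * v \<le> g (t + L) v"
        using T0 by blast
      have "(K + b * L) / (a' - b) \<le> v" using v by (simp add: V_def)
      then have "K + b * L \<le> v * (a' - b)" using ab by (simp add: pos_divide_le_eq)
      then have 1: "b * (L + v) + K \<le> g (t + L) v" using v by (simp add: algebra_simps)
      have "\<epsilon> / 2 * (L + 2 * L / \<epsilon>) \<le> \<epsilon> / 2 * t"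
        using T t \<epsilon> by (intro mult_left_mono) auto
      moreover have "\<epsilon> / 2 * (L + 2 * L / \<epsilon>) = \<epsilon> / 2 * L + L"
        using \<epsilon> by (simp add: field_simps)
      ultimately have "L + v \<le> \<epsilon> * t" using v by (simp add: algebra_simps)
      then show ?thesis using 1 v by (auto simp: V_def)
    qed
    \<comment> \<open>This form of the bound telescopes over steps, and it is trivial once \<open>u\<close> is shorter than
      one step, as its left-hand side is then not positive.\<close>
    have chain: "b * (t + u) / (1 + \<epsilon>) - b * t \<le> g t u"
      if "T \<le> t" "0 \<le> u" "u \<le> real n" for n t u
      using that
    proof (induction n arbitrary: t u)
      case 0
      then have u: "u = 0" by simp
      have "b * t / (1 + \<epsilon>) \<le> b * t"
        using 0 T ab \<epsilon> by (simp add: field_simps)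
      then show ?case using nonneg[of t u] 0 T u by simp
    next
      case (Suc n)
      have t: "0 < t" using Suc T by linarith
      obtain v where v: "1 \<le> v" "L + v \<le> \<epsilon> * t" "b * (L + v) + K \<le> g (t + L) v"
        using step Suc by blast
      show ?case
      proof (cases "u < L + v")
        case True
        then have "t + u \<le> (1 + \<epsilon>) * t" using v by (simp add: algebra_simps)
        then have "b * (t + u) \<le> b * ((1 + \<epsilon>) * t)" using ab by (intro mult_left_mono) auto
        then have "b * (t + u) / (1 + \<epsilon>) \<le> b * t"
          using \<epsilon> by (simp add: pos_divide_le_eq algebra_simps)
        then show ?thesis using nonneg[of t u] t Suc by linarith
      next
        case False
        define w where "w = u - L - v"
        have w: "0 \<le> w" "w \<le> real n" "u = L + v + w"
          using False Suc v L_nonneg by (auto simp: w_def)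
        have "b * ((t + L + v) + w) / (1 + \<epsilon>) - b * (t + L + v) \<le> g (t + L + v) w"
          using Suc.IH[of "t + L + v" w] w v Suc L_nonneg by simp
        moreover have "g (t + L) v + g (t + L + v) w - K \<le> g t (L + v + w)"
          using glue t v w by simp
        ultimately show ?thesis using v w by (simp add: algebra_simps)
      qed
    qed
    have big: "b * (u - \<epsilon> * t) / (1 + \<epsilon>) \<le> g t u" if "T \<le> t" "0 \<le> u" for t u
    proof -
      have "b * (u - \<epsilon> * t) / (1 + \<epsilon>) = b * (t + u) / (1 + \<epsilon>) - b * t"
        using \<epsilon> by (simp add: field_simps)
      then show ?thesis using chain[OF that, of "nat \<lceil>u\<rceil>"] that by (simp add: real_nat_ceiling_ge)
    qed
    \<comment> \<open>Small \<open>t\<close> are moved up to \<open>T\<close> by shrinking the big ball, at a bounded cost.\<close>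
    have all: "b * (u - \<epsilon> * t) - b * T * (1 + \<epsilon>) \<le> g t u * (1 + \<epsilon>)"
      if "0 < t" "T \<le> u" for t u
    proof (cases "T \<le> t")
      case True
      have "b * (u - \<epsilon> * t) \<le> g t u * (1 + \<epsilon>)"
        using big[OF True, of u] that T \<epsilon> by (simp add: pos_divide_le_eq)
      moreover have "0 \<le> b * T * (1 + \<epsilon>)" using ab T \<epsilon> by simp
      ultimately show ?thesis by linarith
    next
      case False
      have "b * ((u - (T - t)) - \<epsilon> * T) / (1 + \<epsilon>) \<le> g T (u - (T - t))"
        using big[of T "u - (T - t)"] that by simp
      also have "\<dots> \<le> g t u" using shift[of t "T - t" u] that False by simp
      finally have "b * ((u - (T - t)) - \<epsilon> * T) \<le> g t u * (1 + \<epsilon>)"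
        using \<epsilon> by (simp add: pos_divide_le_eq)
      moreover have "0 \<le> b * t" "0 \<le> b * (\<epsilon> * t)" using ab \<epsilon> that by simp_all
      ultimately show ?thesis by (simp add: algebra_simps)
    qed
    define C where "C = max T (2 * b * T * (1 + \<epsilon>) / (b - a))"
    show "\<exists>C. \<forall>t>0. \<forall>u. \<epsilon>0 * t \<le> u \<longrightarrow> C \<le> u \<longrightarrow> a * u \<le> g t u"
    proof (intro exI[of _ C] allI impI)
      fix t u :: real
      assume t: "0 < t" and u: "\<epsilon>0 * t \<le> u" "C \<le> u"
      have "2 * b * T * (1 + \<epsilon>) / (b - a) \<le> u" using u by (simp add: C_def)
      then have *: "b * T * (1 + \<epsilon>) \<le> (b - a) / 2 * u"
        using ab by (simp add: pos_divide_le_eq algebra_simps)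
      have "t \<le> u / \<epsilon>0" using u \<epsilon>0 by (simp add: pos_le_divide_eq mult.commute)
      then have "b * (\<epsilon> * t) \<le> b * (\<epsilon> * (u / \<epsilon>0))"
        using ab \<epsilon> by (intro mult_left_mono) auto
      then have "b * u - b * (\<epsilon> * (u / \<epsilon>0)) \<le> b * (u - \<epsilon> * t)"
        by (simp add: algebra_simps)
      moreover have "b * u - b * (\<epsilon> * (u / \<epsilon>0)) = (b - a) / 2 * u + a * (1 + \<epsilon>) * u"
      proof -
        have "b * u - b * (\<epsilon> * (u / \<epsilon>0)) = b * (1 - \<epsilon> / \<epsilon>0) * u" by (simp add: algebra_simps)
        also have "b * (1 - \<epsilon> / \<epsilon>0) = (b - a) / 2 + a * (1 + \<epsilon>)"
          using slack by linarith
        finally show ?thesis by (simp add: algebra_simps)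
      qed
      moreover have "b * (u - \<epsilon> * t) - b * T * (1 + \<epsilon>) \<le> g t u * (1 + \<epsilon>)"
        using all t u by (simp add: C_def)
      ultimately have "a * (1 + \<epsilon>) * u \<le> g t u * (1 + \<epsilon>)"
        using * by linarith
      then have "(a * u) * (1 + \<epsilon>) \<le> g t u * (1 + \<epsilon>)" by (simp only: mult_ac)
      then show "a * u \<le> g t u" using \<epsilon> by simp
    qed
  qed
qed

lemma phi_exponent_linear_if_far:
  assumes far: "far_exponent g a" and l: "0 < l" and a: "0 \<le> a"
  shows "phi_exponent g (\<lambda>t. l * t) a"
proof -
  obtain C where C: "\<And>t u. 0 < t \<Longrightarrow> l * t \<le> u \<Longrightarrow> C \<le> u \<Longrightarrow> a * u \<le> g t u"
    using far l unfolding far_exponent_def by meson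
  show ?thesis
    unfolding phi_exponent_def
  proof (intro exI[of _ "a * \<bar>C\<bar>"] allI impI)
    fix t :: real
    assume t: "0 < t"
    then have u: "0 \<le> l * t" using l by simp
    show "a * (l * t) - a * \<bar>C\<bar> \<le> g t (l * t)"
    proof (cases "C \<le> l * t")
      case True
      moreover have "0 \<le> a * \<bar>C\<bar>" using a by simp
      ultimately show ?thesis using C[of t "l * t"] t by linarith
    next
      case False
      then have "a * (l * t) \<le> a * \<bar>C\<bar>" using a by (intro mult_left_mono) auto
      then show ?thesis using nonneg[OF t u] by linarith
    qed
  qed
qed

lemma far_exponent_if_sublinear:
  assumes less: "a < a'" and e: "phi_exponent g \<psi> a'"
    and lim: "filterlim \<psi> at_top at_top"
    and small: "\<And>\<epsilon>. 0 < \<epsilon> \<Longrightarrow> eventually (\<lambda>t. \<psi> t \<le> \<epsilon> * t) at_top"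
  shows "far_exponent g a"
proof (rule far_exponent_if_short_steps)
  define b where "b = (a + a') / 2"
  show "a < b" using less by (simp add: b_def)
  obtain c where c: "\<And>t. 0 < t \<Longrightarrow> a' * \<psi> t - c \<le> g t (\<psi> t)"
    using e unfolding phi_exponent_def by blast
  fix \<epsilon> V :: real
  assume \<epsilon>: "0 < \<epsilon>"
  have "eventually (\<lambda>t. max V (c / (a' - b)) \<le> \<psi> t) at_top"
    using lim unfolding filterlim_at_top by blast
  with small[OF \<epsilon>] eventually_gt_at_top[of 0]
  have "eventually (\<lambda>t. \<exists>v. V \<le> v \<and> v \<le> \<epsilon> * t \<and> b * v \<le> g t v) at_top"
  proof eventually_elim
    case (elim t)
    have "c / (a' - b) \<le> \<psi> t" using elim by simp
    moreover have "0 < a' - b" using less by (simp add: b_def)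
    ultimately have "c \<le> \<psi> t * (a' - b)" by (simp add: pos_divide_le_eq)
    then have "b * \<psi> t \<le> g t (\<psi> t)" using c[of t] elim by (simp add: algebra_simps)
    then show ?case using elim by (intro exI[of _ "\<psi> t"]) auto
  qed
  then show "\<exists>T. \<forall>t\<ge>T. \<exists>v. V \<le> v \<and> v \<le> \<epsilon> * t \<and> b * v \<le> g t v"
    unfolding eventually_at_top_linorder .
qed

lemma far_exponent_if_linear:
  assumes less: "a < a'"
    and e: "\<And>\<epsilon>. 0 < \<epsilon> \<Longrightarrow> \<exists>l>0. l \<le> \<epsilon> \<and> phi_exponent g (\<lambda>t. l * t) a'"
  shows "far_exponent g a"
proof (rule far_exponent_if_short_steps)
  define b where "b = (a + a') / 2"
  show "a < b" using less by (simp add: b_def)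
  fix \<epsilon> V :: real
  assume \<epsilon>: "0 < \<epsilon>"
  obtain l c where l: "0 < l" "l \<le> \<epsilon>"
    and c: "\<And>t. 0 < t \<Longrightarrow> a' * (l * t) - c \<le> g t (l * t)"
    using e[OF \<epsilon>] unfolding phi_exponent_def by blast
  define T where "T = max 1 (max V (c / (a' - b)) / l)"
  show "\<exists>T. \<forall>t\<ge>T. \<exists>v. V \<le> v \<and> v \<le> \<epsilon> * t \<and> b * v \<le> g t v"
  proof (rule exI[of _ T], intro allI impI)
    fix t
    assume t: "T \<le> t"
    then have "max V (c / (a' - b)) / l \<le> t" and t0: "0 < t" by (auto simp: T_def)
    then have *: "max V (c / (a' - b)) \<le> l * t" using l by (simp add: pos_divide_le_eq mult.commute)
    then have "c / (a' - b) \<le> l * t" by simp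
    moreover have "0 < a' - b" using less by (simp add: b_def)
    ultimately have "c \<le> l * t * (a' - b)" by (simp add: pos_divide_le_eq)
    then have "b * (l * t) \<le> g t (l * t)" using c[OF t0] by (simp add: algebra_simps)
    then show "\<exists>v. V \<le> v \<and> v \<le> \<epsilon> * t \<and> b * v \<le> g t v"
      using * l t0 by (intro exI[of _ "l * t"]) auto
  qed
qed

text \<open>
A bound for \<open>u > \<psi> t\<close> and large \<open>u\<close> suffices: the boundary case follows by passing to \<open>u + 1\<close> with the
growth bound, and bounded \<open>u\<close> are absorbed by the constant.
\<close>

lemma quasi_exponentI:
  assumes a: "0 \<le> a" and pos: "\<And>t. 0 < t \<Longrightarrow> 0 \<le> \<psi> t"
    and C: "\<And>t u. 0 < t \<Longrightarrow> \<psi> t < u \<Longrightarrow> C \<le> u \<Longrightarrow> a * u \<le> g t u"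
  shows "quasi_exponent g \<psi> a"
  unfolding quasi_exponent_def
proof (intro exI[of _ "a * \<bar>C\<bar> + D + K"] allI impI)
  fix t u
  assume t: "0 < t" and u: "\<psi> t \<le> u"
  have u0: "0 \<le> u" using pos[OF t] u by linarith
  have aC: "0 \<le> a * \<bar>C\<bar>" using a by simp
  show "a * u - (a * \<bar>C\<bar> + D + K) \<le> g t u"
  proof (cases "C \<le> u + 1")
    case True
    have "a * u \<le> a * (u + 1)" using a by (intro mult_left_mono) auto
    also have "\<dots> \<le> g t (u + 1)" using C[OF t, of "u + 1"] u True by simp
    also have "\<dots> \<le> g t u + D + K" using growth[OF t u0, of 1] by simp
    finally show ?thesis using aC by linarith
  next
    case False
    then have "a * u \<le> a * \<bar>C\<bar>" using a by (intro mult_left_mono) auto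
    then show ?thesis using nonneg[OF t u0] D_nonneg K_nonneg by linarith
  qed
qed

end

section \<open>Envelopes\<close>

text \<open>
The least function \<open>\<psi>\<close> on the positive half-line with \<open>p \<le> \<psi> \<tau>\<close> for all \<open>(\<tau>, p)\<close> in \<open>P\<close> such that
\<open>\<psi> t\<close> does not decrease and \<open>\<psi> t / t\<close> does not increase: these two conditions force
\<open>\<psi> t \<ge> p\<close> for \<open>t \<ge> \<tau>\<close> and \<open>\<psi> t \<ge> p * t / \<tau>\<close> for \<open>t \<le> \<tau>\<close>.
\<close>

definition envelope :: "(real \<times> real) set \<Rightarrow> real \<Rightarrow> real" where
  "envelope P t = (SUP (\<tau>, p)\<in>P. p * min 1 (t / \<tau>))"

context
  fixes P :: "(real \<times> real) set"
  assumes below: "\<And>\<tau> p. (\<tau>, p) \<in> P \<Longrightarrow> 0 < p \<and> p \<le> \<tau>"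
    and unbounded: "\<And>U. \<exists>(\<tau>, p)\<in>P. U \<le> p"
begin

lemma weighted_le:
  assumes "(\<tau>, p) \<in> P" "0 < t"
  shows "p * min 1 (t / \<tau>) \<le> t"
proof -
  have "0 < p" "p \<le> \<tau>" using below assms by auto
  have "p * min 1 (t / \<tau>) \<le> p * (t / \<tau>)" using \<open>0 < p\<close> by (intro mult_left_mono) auto
  also have "\<dots> \<le> t" using \<open>0 < p\<close> \<open>p \<le> \<tau>\<close> assms by (simp add: field_simps)
  finally show ?thesis .
qed

lemma le_envelope: "(\<tau>, p) \<in> P \<Longrightarrow> 0 < t \<Longrightarrow> p * min 1 (t / \<tau>) \<le> envelope P t"
  unfolding envelope_def
  by (rule cSUP_upper2[where x = "(\<tau>, p)"]) (use weighted_le in \<open>auto intro!: bdd_aboveI2[of _ _ t]\<close>)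

lemma envelope_le:
  assumes "\<And>\<tau> p. (\<tau>, p) \<in> P \<Longrightarrow> p * min 1 (t / \<tau>) \<le> B"
  shows "envelope P t \<le> B"
  unfolding envelope_def by (rule cSUP_least) (use unbounded assms in auto)

lemma point_le_envelope: "(\<tau>, p) \<in> P \<Longrightarrow> p \<le> envelope P \<tau>"
  using le_envelope[of \<tau> p \<tau>] below[of \<tau> p] by simp

lemma envelope_mono:
  assumes "0 < t" "t \<le> t'"
  shows "envelope P t \<le> envelope P t'"
proof (rule envelope_le)
  fix \<tau> p
  assume p: "(\<tau>, p) \<in> P"
  have "t / \<tau> \<le> t' / \<tau>" using below[OF p] assms by (simp add: divide_right_mono)
  then have "p * min 1 (t / \<tau>) \<le> p * min 1 (t' / \<tau>)"
    using below[OF p] by (intro mult_left_mono) auto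
  also have "\<dots> \<le> envelope P t'" using p assms by (intro le_envelope) auto
  finally show "p * min 1 (t / \<tau>) \<le> envelope P t'" .
qed

lemma envelope_slope_antimono:
  assumes "0 < t" "t \<le> t'"
  shows "t * envelope P t' \<le> t' * envelope P t"
proof -
  have "envelope P t' \<le> t' / t * envelope P t"
  proof (rule envelope_le)
    fix \<tau> p
    assume p: "(\<tau>, p) \<in> P"
    have "min 1 (t' / \<tau>) \<le> t' / t * min 1 (t / \<tau>)"
      using below[OF p] assms by (auto simp: min_def field_simps)
    then have "p * min 1 (t' / \<tau>) \<le> p * (t' / t * min 1 (t / \<tau>))"
      using below[OF p] by (intro mult_left_mono) auto
    also have "\<dots> = t' / t * (p * min 1 (t / \<tau>))" by simp
    also have "\<dots> \<le> t' / t * envelope P t"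
      using p assms by (intro mult_left_mono le_envelope) auto
    finally show "p * min 1 (t' / \<tau>) \<le> t' / t * envelope P t" .
  qed
  then show ?thesis using assms by (simp add: field_simps)
qed

lemma envelope_pos: "0 < t \<Longrightarrow> 0 < envelope P t"
proof -
  assume t: "0 < t"
  obtain \<tau> p where p: "(\<tau>, p) \<in> P" using unbounded by blast
  have "0 < p * min 1 (t / \<tau>)" using below[OF p] t by simp
  then show ?thesis using le_envelope[OF p t] by linarith
qed

lemma envelope_at_top: "filterlim (envelope P) at_top at_top"
  unfolding filterlim_at_top eventually_at_top_linorder
proof
  fix U
  obtain \<tau> p where p: "(\<tau>, p) \<in> P" "U \<le> p" using unbounded[of U] by blast
  have "U \<le> envelope P t" if "\<tau> \<le> t" for t
    using point_le_envelope[OF p(1)] envelope_mono[of \<tau> t] below[OF p(1)] that p by linarith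
  then show "\<exists>N. \<forall>t\<ge>N. U \<le> envelope P t" by blast
qed

lemma admissible_envelope: "admissible (envelope P)"
  unfolding admissible_def
  using envelope_pos envelope_mono envelope_slope_antimono envelope_at_top
  by (auto intro: envelope_le weighted_le)

text \<open>
If \<open>(\<tau>, p)\<close> nearly attains the supremum that defines the envelope at some \<open>t\<close>, then the envelope is
nearly equal to \<open>p\<close> at \<open>\<tau>\<close> itself. Indeed, between \<open>t\<close> and \<open>\<tau>\<close> the function
\<open>\<lambda>t. p * min 1 (t / \<tau>)\<close> moves as fast as the two monotonicity conditions allow the envelope to move.
\<close>

lemma envelope_contact:
  assumes \<delta>: "0 < \<delta>"
  shows "\<exists>(\<tau>, p)\<in>P. U \<le> p \<and> envelope P \<tau> \<le> (1 + \<delta>) * p"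
proof -
  obtain t where t: "0 < t" "(1 + \<delta>) * U \<le> envelope P t"
    using envelope_at_top eventually_conj[OF eventually_gt_at_top[of 0]]
    unfolding filterlim_at_top by (metis (mono_tags, lifting) eventually_at_top_linorder order_refl)
  have "envelope P t / (1 + \<delta>) < envelope P t"
    using envelope_pos[OF t(1)] \<delta> by (simp add: field_simps)
  then obtain \<tau> p where p: "(\<tau>, p) \<in> P" "envelope P t / (1 + \<delta>) < p * min 1 (t / \<tau>)"
    using envelope_le[of t "envelope P t / (1 + \<delta>)"] by fastforce
  have p0: "0 < p" "0 < \<tau>" using below[OF p(1)] by auto
  have *: "envelope P t \<le> (1 + \<delta>) * (p * min 1 (t / \<tau>))"
    using p \<delta> by (simp add: field_simps)
  have "p * min 1 (t / \<tau>) \<le> p * 1" using p0 by (intro mult_left_mono) auto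
  then have "envelope P t \<le> (1 + \<delta>) * p" using * \<delta> by (smt (verit) mult_left_mono)
  then have U: "U \<le> p" using t \<delta> by (smt (verit) mult_le_cancel_left)
  have "envelope P \<tau> \<le> (1 + \<delta>) * p"
  proof (cases "\<tau> \<le> t")
    case True
    then show ?thesis using envelope_mono[OF p0(2) True] \<open>envelope P t \<le> (1 + \<delta>) * p\<close> by linarith
  next
    case False
    then have "t * envelope P \<tau> \<le> \<tau> * envelope P t"
      using envelope_slope_antimono t by simp
    also have "\<dots> \<le> \<tau> * ((1 + \<delta>) * (p * (t / \<tau>)))"
      using * p0 False by (intro mult_left_mono) (auto simp: min_def split: if_splits)
    also have "\<dots> = t * ((1 + \<delta>) * p)" using p0 by simp
    finally show ?thesis using t by simp
  qed
  then show ?thesis using p U by blast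
qed

end

section \<open>Scale functions with prescribed exponent\<close>

context scale_profile
begin

text \<open>
The envelope is taken over the points \<open>(t, u)\<close> with \<open>u \<le> t\<close> and \<open>g t u < s * u\<close>, where \<open>u \<le> t\<close> is what
admissibility requires. By the far exponent \<open>b > s\<close> this restriction only drops points with bounded
\<open>u\<close>, so that \<open>g t u \<ge> s * u\<close> holds above the envelope for all large \<open>u\<close>. Near the contact points \<open>g\<close> has
slope about \<open>s\<close> or less on the graph of the envelope, which excludes larger exponents there. If the
points have bounded \<open>u\<close>, their envelope does not tend to infinity; therefore a sequence of points
whose slopes tend to \<open>s\<close> from above is added. It exists since no slope above \<open>s\<close> is a lower exponent.
\<close>

lemma exists_admissible_if_far_above:
  assumes s: "0 \<le> s" and sb: "s < b" and far: "far_exponent g b"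
    and low: "\<And>a. s < a \<Longrightarrow> \<not> lower_exponent g a"
  shows "\<exists>\<psi>. admissible \<psi> \<and> quasi_exponent g \<psi> s \<and> (\<forall>a>s. \<not> phi_exponent g \<psi> a)"
proof -
  obtain C where C: "\<And>t u. 0 < t \<Longrightarrow> t \<le> u \<Longrightarrow> C \<le> u \<Longrightarrow> b * u \<le> g t u"
    using far unfolding far_exponent_def by (metis mult_1 zero_less_one)
  define \<sigma> where "\<sigma> k = s + (b - s) / (real k + 2)" for k :: nat
  have \<sigma>: "s < \<sigma> k" "\<sigma> k \<le> b" for k
  proof -
    show "s < \<sigma> k" using sb by (simp add: \<sigma>_def)
    have "(b - s) / (real k + 2) \<le> (b - s) / 1" using sb by (intro divide_left_mono) auto
    then show "\<sigma> k \<le> b" by (simp add: \<sigma>_def)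
  qed
  have "\<exists>q. 0 < snd q \<and> snd q \<le> fst q \<and> real k \<le> snd q \<and> g (fst q) (snd q) < \<sigma> k * snd q" for k
  proof -
    \<comment> \<open>As \<open>g\<close> is nonnegative, a failure by this amount forces \<open>u > max \<bar>C\<bar> k\<close>.\<close>
    have "\<not> (\<forall>t>0. \<forall>u>0. \<sigma> k * u - b * max \<bar>C\<bar> (real k) \<le> g t u)"
      using low[OF \<sigma>(1)[of k]] unfolding lower_exponent_def by blast
    then obtain t u where tu: "0 < t" "0 < u" "g t u < \<sigma> k * u - b * max \<bar>C\<bar> (real k)"
      by (auto simp: not_le)
    have "0 \<le> g t u" using nonneg tu by simp
    moreover have "\<sigma> k * u \<le> b * u" using \<sigma> tu by simp
    ultimately have "b * max \<bar>C\<bar> (real k) < b * u" using tu by linarith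
    then have u: "\<bar>C\<bar> < u" "real k < u" using s sb by auto
    have "0 \<le> b * max \<bar>C\<bar> (real k)" using s sb by simp
    then have g: "g t u < \<sigma> k * u" using tu by linarith
    have "u \<le> t"
    proof (rule ccontr)
      assume "\<not> u \<le> t"
      then have "b * u \<le> g t u" using C[of t u] tu u by simp
      then show False using g \<open>\<sigma> k * u \<le> b * u\<close> by linarith
    qed
    then show ?thesis using tu u g by (intro exI[of _ "(t, u)"]) auto
  qed
  then obtain q where q: "\<And>k. 0 < snd (q k)" "\<And>k. snd (q k) \<le> fst (q k)"
    "\<And>k. real k \<le> snd (q k)" "\<And>k. g (fst (q k)) (snd (q k)) < \<sigma> k * snd (q k)"
    by metis
  define P where "P = {(t, u). 0 < u \<and> u \<le> t \<and> g t u < s * u} \<union> range q"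
  have below: "0 < p \<and> p \<le> \<tau>" if "(\<tau>, p) \<in> P" for \<tau> p
    using that q(1,2) unfolding P_def by (auto) (metis fst_conv snd_conv)+
  have unbounded: "\<exists>(\<tau>, p)\<in>P. U \<le> p" for U
  proof -
    have "U \<le> snd (q (nat \<lceil>U\<rceil>))" using q(3)[of "nat \<lceil>U\<rceil>"] by linarith
    then show ?thesis unfolding P_def by (intro bexI[of _ "q (nat \<lceil>U\<rceil>)"]) (auto split: prod.split)
  qed
  note env = below unbounded
  define \<psi> where "\<psi> = envelope P"
  have adm: "admissible \<psi>" unfolding \<psi>_def by (rule admissible_envelope[OF env])
  have quasi: "quasi_exponent g \<psi> s"
  proof (rule quasi_exponentI[OF s, where C = "\<bar>C\<bar>"])
    show "0 \<le> \<psi> t" if "0 < t" for t using adm that unfolding admissible_def by (simp add: less_imp_le)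
    fix t u
    assume t: "0 < t" and u: "\<psi> t < u" "\<bar>C\<bar> \<le> u"
    have u0: "0 < u" using adm t u unfolding admissible_def by (meson order.strict_trans)
    show "s * u \<le> g t u"
    proof (cases "u \<le> t")
      case True
      have "(t, u) \<notin> P" using point_le_envelope[OF env, of t u] u unfolding \<psi>_def by auto
      then show ?thesis using True u0 unfolding P_def by auto
    next
      case False
      then have "b * u \<le> g t u" using C[of t u] t u by simp
      moreover have "s * u \<le> b * u" using sb u0 by simp
      ultimately show ?thesis by linarith
    qed
  qed
  have "\<not> phi_exponent g \<psi> a" if a: "s < a" for a
  proof
    assume "phi_exponent g \<psi> a"
    then obtain c where c: "\<And>t. 0 < t \<Longrightarrow> a * \<psi> t - c \<le> g t (\<psi> t)"
      unfolding phi_exponent_def by blast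
    define a' where "a' = (s + a) / 2"
    define \<delta> where "\<delta> = (a - a') / (2 * (D + 1))"
    have a': "s < a'" "a' < a" using a by (auto simp: a'_def)
    have \<delta>: "0 < \<delta>" using a' D_nonneg by (simp add: \<delta>_def)
    have D\<delta>: "D * \<delta> \<le> (a - a') / 2"
      using a' D_nonneg by (simp add: \<delta>_def field_simps)
    obtain n :: nat where n: "(b - s) / (a' - s) < real n" using reals_Archimedean2 by blast
    have \<sigma>n: "\<sigma> k \<le> a'" if "n \<le> k" for k
    proof -
      have "(b - s) / (a' - s) \<le> real k + 2" using n that by linarith
      then have "(b - s) / (real k + 2) \<le> a' - s" using a' by (simp add: field_simps)
      then show ?thesis by (simp add: \<sigma>_def)
    qed
    \<comment> \<open>Beyond the sum, a point of the sequence has index at least \<open>n\<close> and so slope at most \<open>a'\<close>;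
      the last summand makes \<open>(a - a') / 2 * p\<close> exceed the constants.\<close>
    define U where "U = (\<Sum>k<n. snd (q k)) + 1 + 2 * (\<bar>c\<bar> + K + 1) / (a - a')"
    obtain \<tau> p where p: "(\<tau>, p) \<in> P" "U \<le> p" "\<psi> \<tau> \<le> (1 + \<delta>) * p"
      using envelope_contact[OF env \<delta>, of U] unfolding \<psi>_def by blast
    have p0: "0 < p" "0 < \<tau>" using below[OF p(1)] by auto
    have fr: "0 \<le> 2 * (\<bar>c\<bar> + K + 1) / (a - a')" using a' K_nonneg by simp
    have sum: "0 \<le> (\<Sum>k<n. snd (q k))" using q(1) by (intro sum_nonneg) (simp add: less_imp_le)
    have g: "g \<tau> p \<le> a' * p"
    proof (cases "(\<tau>, p) \<in> range q")
      case True
      then obtain k where k: "(\<tau>, p) = q k" by auto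
      have "n \<le> k"
      proof (rule ccontr)
        assume "\<not> n \<le> k"
        then have "snd (q k) \<le> (\<Sum>k<n. snd (q k))"
          using q(1) by (intro member_le_sum) (auto simp: less_imp_le)
        then show False using p(2) fr k[symmetric] unfolding U_def by simp
      qed
      then have "\<sigma> k * p \<le> a' * p" using \<sigma>n p0 by simp
      then show ?thesis using q(4)[of k] k[symmetric] by simp
    next
      case False
      then have "g \<tau> p < s * p" using p(1) unfolding P_def by auto
      moreover have "s * p \<le> a' * p" using a' p0 by simp
      ultimately show ?thesis by linarith
    qed
    have le: "p \<le> \<psi> \<tau>" using point_le_envelope[OF env p(1)] unfolding \<psi>_def .
    have "a * p - c \<le> a * \<psi> \<tau> - c" using le s a by simp
    also have "\<dots> \<le> g \<tau> (p + (\<psi> \<tau> - p))" using c p0 by simp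
    also have "\<dots> \<le> g \<tau> p + D * (\<psi> \<tau> - p) + K" using growth[of \<tau> p "\<psi> \<tau> - p"] p0 le by simp
    also have "\<dots> \<le> a' * p + D * (\<delta> * p) + K"
      using g p D_nonneg by (intro add_mono mult_left_mono) (auto simp: algebra_simps)
    also have "D * (\<delta> * p) \<le> (a - a') / 2 * p" using mult_right_mono[OF D\<delta>, of p] p0 by simp
    finally have "(a - a') / 2 * p \<le> c + K" by (simp add: field_simps)
    moreover have "2 * (\<bar>c\<bar> + K + 1) / (a - a') \<le> p" using p(2) sum unfolding U_def by linarith
    then have "\<bar>c\<bar> + K + 1 \<le> (a - a') / 2 * p" using a' by (simp add: field_simps)
    ultimately show False by linarith
  qed
  then show ?thesis using adm quasi by blast
qed

text \<open>
Here \<open>s\<close> is the supremum of the slopes at far scales, and the envelope of the previous lemma may fail to be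
sublinear. Instead \<open>\<psi>\<close> is taken sublinear but so large that the slopes \<open>s - \<epsilon> k\<close> have set in above
it, by a diagonal choice over \<open>k\<close>. For a sublinear \<open>\<psi>\<close> an exponent \<open>a > s\<close> on the graph of \<open>\<psi>\<close> would
provide short steps, and then slopes between \<open>s\<close> and \<open>a\<close> would be far exponents.
\<close>

lemma exists_admissible_if_not_far_above:
  assumes s: "0 \<le> s" and far: "\<And>a. a < s \<Longrightarrow> far_exponent g a"
    and nfar: "\<And>b. s < b \<Longrightarrow> \<not> far_exponent g b"
  shows "\<exists>\<psi>. admissible \<psi> \<and> (\<forall>a\<ge>0. a < s \<longrightarrow> quasi_exponent g \<psi> a) \<and>
    (\<forall>a>s. \<not> phi_exponent g \<psi> a)"
proof -
  define \<epsilon> where "\<epsilon> k = 1 / (real k + 1)" for k :: nat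
  have \<epsilon>: "0 < \<epsilon> k" for k by (simp add: \<epsilon>_def)
  have \<epsilon>_mono: "\<epsilon> k \<le> \<epsilon> j" if "j \<le> k" for j k using that by (simp add: \<epsilon>_def field_simps)
  have "\<exists>C. real k + 1 \<le> C \<and>
      (\<forall>t>0. \<forall>u. \<epsilon> k * t \<le> u \<longrightarrow> C \<le> u \<longrightarrow> (s - \<epsilon> k) * u \<le> g t u)" for k
  proof -
    obtain C where "\<forall>t>0. \<forall>u. \<epsilon> k * t \<le> u \<longrightarrow> C \<le> u \<longrightarrow> (s - \<epsilon> k) * u \<le> g t u"
      using far[of "s - \<epsilon> k"] \<epsilon>[of k] unfolding far_exponent_def by auto
    then show ?thesis by (intro exI[of _ "max C (real k + 1)"]) auto
  qed
  then obtain C where Ck: "\<And>k. real k + 1 \<le> C k"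
    and C: "\<And>k t u. 0 < t \<Longrightarrow> \<epsilon> k * t \<le> u \<Longrightarrow> C k \<le> u \<Longrightarrow> (s - \<epsilon> k) * u \<le> g t u"
    by metis
  define f where "f t k = max (\<epsilon> k * t) (C k)" for t k
  define \<psi> where "\<psi> t = min t (INF k. f t k)" for t
  have f_pos: "0 < f t k" for t k using Ck[of k] by (simp add: f_def less_max_iff_disj)
  have bdd: "bdd_below (range (f t))" for t using f_pos by (intro bdd_belowI2[of _ 0]) (simp add: less_imp_le)
  have \<psi>_le: "\<psi> t \<le> f t k" "\<psi> t \<le> t" for t k
    unfolding \<psi>_def using cINF_lower[OF bdd, of k t] by auto
  have le_\<psi>: "B \<le> \<psi> t" if "B \<le> t" "\<And>k. B \<le> f t k" for B t
    unfolding \<psi>_def using that by (auto intro: cINF_greatest)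
  \<comment> \<open>Either \<open>k + 1 \<ge> sqrt t\<close>, and \<open>C k\<close> is large, or \<open>\<epsilon> k * t \<ge> sqrt t\<close>.\<close>
  have sqrt: "min t (sqrt t) \<le> \<psi> t" if t: "0 < t" for t
  proof (rule le_\<psi>)
    fix k
    have "sqrt t \<le> f t k"
    proof (cases "sqrt t \<le> real k + 1")
      case True
      then show ?thesis using Ck[of k] by (simp add: f_def le_max_iff_disj)
    next
      case False
      then have "sqrt t * (real k + 1) \<le> sqrt t * sqrt t" using t by (intro mult_left_mono) auto
      then have "sqrt t \<le> \<epsilon> k * t" using t by (simp add: \<epsilon>_def field_simps)
      then show ?thesis by (simp add: f_def)
    qed
    then show "min t (sqrt t) \<le> f t k" by simp
  qed simp
  have lim: "filterlim \<psi> at_top at_top"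
  proof (rule filterlim_at_top_mono)
    show "filterlim (\<lambda>t::real. sqrt t) at_top at_top" by (rule sqrt_at_top)
    show "eventually (\<lambda>t. sqrt t \<le> \<psi> t) at_top"
      using eventually_ge_at_top[of 1]
    proof eventually_elim
      case (elim t)
      have "sqrt t * 1 \<le> sqrt t * sqrt t" using elim by (intro mult_left_mono) auto
      then show ?case using sqrt[of t] elim by simp
    qed
  qed
  have mono: "\<psi> t \<le> \<psi> t'" if "0 < t" "t \<le> t'" for t t'
  proof (rule le_\<psi>)
    show "\<psi> t \<le> t'" using \<psi>_le(2)[of t] that by linarith
    fix k
    have "f t k \<le> f t' k" using that \<epsilon>[of k] unfolding f_def by (intro max.mono mult_left_mono) auto
    then show "\<psi> t \<le> f t' k" using \<psi>_le(1)[of t k] by linarith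
  qed
  have slope: "t * \<psi> t' \<le> t' * \<psi> t" if t: "0 < t" "t \<le> t'" for t t'
  proof -
    have "t / t' * \<psi> t' \<le> \<psi> t"
    proof (rule le_\<psi>)
      show "t / t' * \<psi> t' \<le> t" using \<psi>_le(2)[of t'] t by (simp add: field_simps)
      fix k
      have "t / t' * \<psi> t' \<le> t / t' * f t' k" using \<psi>_le(1)[of t' k] t by (intro mult_left_mono) auto
      also have "\<dots> = max (\<epsilon> k * t) (t / t' * C k)"
        using t by (simp add: f_def max_mult_distrib_left mult.commute)
      also have "\<dots> \<le> f t k"
      proof -
        have "t / t' * C k \<le> 1 * C k" using t Ck[of k] by (intro mult_right_mono) auto
        then show ?thesis by (auto simp: f_def)
      qed
      finally show "t / t' * \<psi> t' \<le> f t k" .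
    qed
    then show ?thesis using t by (simp add: field_simps)
  qed
  have pos: "0 < \<psi> t" if "0 < t" for t
    using sqrt[OF that] that by (smt (verit) min_def real_sqrt_gt_zero)
  have adm: "admissible \<psi>"
    unfolding admissible_def using pos \<psi>_le(2) mono slope lim by blast
  have quasi: "quasi_exponent g \<psi> a" if a: "0 \<le> a" "a < s" for a
  proof -
    obtain j :: nat where j: "1 / (s - a) < real j" using reals_Archimedean2 by blast
    have "1 < real j * (s - a)" using j a by (simp add: field_simps)
    also have "\<dots> \<le> (real j + 1) * (s - a)" using a by (intro mult_right_mono) auto
    finally have "\<epsilon> j \<le> s - a" by (simp add: \<epsilon>_def field_simps)
    have use: "a * u \<le> g t u" if "0 < t" "\<epsilon> k * t \<le> u" "C k \<le> u" "j \<le> k" for t u k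
    proof -
      have "a * u \<le> (s - \<epsilon> k) * u"
        using \<open>\<epsilon> j \<le> s - a\<close> \<epsilon>_mono[OF that(4)] that Ck[of k] by (intro mult_right_mono) auto
      also have "\<dots> \<le> g t u" using C that by blast
      finally show ?thesis .
    qed
    show ?thesis
    proof (rule quasi_exponentI[OF a(1), where C = "C j"])
      show "0 \<le> \<psi> t" if "0 < t" for t using pos[OF that] by simp
      fix t u
      assume t: "0 < t" and u: "\<psi> t < u" "C j \<le> u"
      show "a * u \<le> g t u"
      proof (cases "\<epsilon> j * t \<le> u")
        case True
        then show ?thesis using use[of t j u] t u by simp
      next
        case False
        have "\<epsilon> j * t \<le> 1 * t" using t by (intro mult_right_mono) (auto simp: \<epsilon>_def)
        then have "\<not> u \<le> \<psi> t" "u \<le> t" using False u by auto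
        then obtain k where k: "f t k < u" using le_\<psi>[of u t] by (meson not_le)
        have ku: "\<epsilon> k * t \<le> u" "C k \<le> u" using k by (auto simp: f_def)
        \<comment> \<open>For \<open>k < j\<close> the region \<open>u \<ge> \<epsilon> k * t\<close> is contained in \<open>u \<ge> \<epsilon> j * t\<close>.\<close>
        have "j \<le> k"
        proof (rule ccontr)
          assume "\<not> j \<le> k"
          then have "\<epsilon> j * t \<le> \<epsilon> k * t" using \<epsilon>_mono[of k j] t by (intro mult_right_mono) auto
          then show False using False ku by linarith
        qed
        then show ?thesis using use ku t by blast
      qed
    qed
  qed
  have small: "eventually (\<lambda>t. \<psi> t \<le> e * t) at_top" if e: "0 < e" for e
  proof -
    obtain k :: nat where k: "1 / e < real k" using reals_Archimedean2 by blast
    have "1 < real k * e" using k e by (simp add: field_simps)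
    then have ke: "\<epsilon> k \<le> e" using e by (simp add: \<epsilon>_def field_simps)
    show ?thesis
      using eventually_ge_at_top[of "C k / e"] eventually_gt_at_top[of 0]
    proof eventually_elim
      case (elim t)
      have "C k \<le> e * t" using elim e by (simp add: field_simps)
      moreover have "\<epsilon> k * t \<le> e * t" using ke elim by simp
      ultimately have "f t k \<le> e * t" by (simp add: f_def)
      then show ?case using \<psi>_le(1)[of t k] by linarith
    qed
  qed
  have "\<not> phi_exponent g \<psi> a" if a: "s < a" for a
  proof
    assume e: "phi_exponent g \<psi> a"
    have "far_exponent g ((s + a) / 2)"
      using a by (intro far_exponent_if_sublinear[OF _ e lim small]) auto
    then show False using nfar[of "(s + a) / 2"] a by simp
  qed
  then show ?thesis using adm quasi by blast
qed

theorem exists_admissible: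
  assumes s: "0 \<le> s" and far: "\<And>a. a < s \<Longrightarrow> far_exponent g a"
    and low: "\<And>a. s < a \<Longrightarrow> \<not> lower_exponent g a"
  shows "\<exists>\<psi>. admissible \<psi> \<and> (\<forall>a\<ge>0. a < s \<longrightarrow> quasi_exponent g \<psi> a) \<and>
    (\<forall>a>s. \<not> phi_exponent g \<psi> a)"
proof (cases "\<exists>b>s. far_exponent g b")
  case True
  then obtain b \<psi> where \<psi>: "admissible \<psi>" "quasi_exponent g \<psi> s" "\<forall>a>s. \<not> phi_exponent g \<psi> a"
    using exists_admissible_if_far_above[OF s _ _ low] by blast
  obtain c where c: "\<And>t u. 0 < t \<Longrightarrow> \<psi> t \<le> u \<Longrightarrow> s * u - c \<le> g t u"
    using \<psi>(2) unfolding quasi_exponent_def by blast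
  have "quasi_exponent g \<psi> a" if "a < s" for a
    unfolding quasi_exponent_def
  proof (intro exI[of _ c] allI impI)
    fix t u
    assume t: "0 < t" "\<psi> t \<le> u"
    have "0 < u" using t \<psi>(1) unfolding admissible_def by (meson less_le_trans)
    then have "a * u \<le> s * u" using that by simp
    then show "a * u - c \<le> g t u" using c[OF t] by linarith
  qed
  then show ?thesis using \<psi> by blast
next
  case False
  then show ?thesis using exists_admissible_if_not_far_above[OF s far] by blast
qed

end

section \<open>Covering numbers\<close>

lemma covering_number_le:
  assumes "finite A" "E \<subseteq> (\<Union>a\<in>A. ball a r)"
  shows "covering_number r E \<le> card A"
  unfolding covering_number_def using assms by (intro cInf_lower) auto

lemma covering_number_attained:
  fixes E :: "'a::heine_borel set"
  assumes "bounded E" "0 < r"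
  obtains A where "finite A" "E \<subseteq> (\<Union>a\<in>A. ball a r)" "card A = covering_number r E"
proof -
  have "compact (closure E)" using assms by (simp add: compact_closure)
  then obtain A where "finite A" "closure E \<subseteq> (\<Union>a\<in>A. ball a r)"
    using assms unfolding compact_eq_totally_bounded by meson
  then have "{card A |A. finite A \<and> E \<subseteq> (\<Union>a\<in>A. ball a r)} \<noteq> {}"
    using closure_subset by blast
  from Inf_nat_def1[OF this] show ?thesis
    using that unfolding covering_number_def by auto
qed

lemma covering_number_mono:
  fixes E :: "'a::heine_borel set"
  assumes "bounded E" "E' \<subseteq> E" "0 < r" "r \<le> r'"
  shows "covering_number r' E' \<le> covering_number r E"
proof -
  obtain A where A: "finite A" "E \<subseteq> (\<Union>a\<in>A. ball a r)" "card A = covering_number r E"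
    using covering_number_attained assms by blast
  have "E' \<subseteq> (\<Union>a\<in>A. ball a r')" using A(2) assms by (force simp: subset_iff)
  then show ?thesis using covering_number_le[OF A(1)] A(3) by metis
qed

lemma covering_number_pos:
  fixes E :: "'a::heine_borel set"
  assumes "bounded E" "0 < r" "E \<noteq> {}"
  shows "1 \<le> covering_number r E"
proof -
  obtain A where A: "finite A" "E \<subseteq> (\<Union>a\<in>A. ball a r)" "card A = covering_number r E"
    using covering_number_attained assms by blast
  then have "A \<noteq> {}" using assms by auto
  then show ?thesis using A by (metis One_nat_def Suc_leI card_gt_0_iff)
qed

text \<open>
Scaling and translating one cover of the unit ball by balls of radius \<open>1 / 4\<close> covers every ball by
the same number of balls of a quarter of its radius. Apart from compactness, this is the only
geometric property of Euclidean space that matters.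
\<close>

lemma covering_number_quarter:
  "\<exists>M\<ge>1. \<forall>(E :: 'a::euclidean_space set) r. bounded E \<longrightarrow> 0 < r \<longrightarrow>
     covering_number (r / 4) E \<le> M * covering_number r E"
proof -
  obtain B :: "'a set" where B: "finite B" "ball 0 1 \<subseteq> (\<Union>b\<in>B. ball b (1 / 4))"
    "card B = covering_number (1 / 4) (ball (0 :: 'a) 1)"
    using covering_number_attained[of "ball (0 :: 'a) 1" "1 / 4"] by auto
  show ?thesis
  proof (intro exI[of _ "card B"] conjI allI impI)
    show "1 \<le> card B" using B(3) covering_number_pos[of "ball (0 :: 'a) 1" "1 / 4"] by simp
    fix E :: "'a set" and r :: real
    assume E: "bounded E" and r: "0 < r"
    obtain A where A: "finite A" "E \<subseteq> (\<Union>a\<in>A. ball a r)" "card A = covering_number r E"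
      using covering_number_attained E r by blast
    define A' where "A' = (\<lambda>(b, a). a + r *\<^sub>R b) ` (B \<times> A)"
    have "E \<subseteq> (\<Union>a\<in>A'. ball a (r / 4))"
    proof
      fix x
      assume "x \<in> E"
      then obtain a where a: "a \<in> A" "dist a x < r" using A by auto
      have "norm ((x - a) /\<^sub>R r) < 1"
        using a r by (simp add: dist_norm norm_minus_commute divide_inverse_commute[symmetric])
      then have "(x - a) /\<^sub>R r \<in> ball 0 1" by simp
      then have "(x - a) /\<^sub>R r \<in> (\<Union>b\<in>B. ball b (1 / 4))" using B(2) by (rule rev_subsetD)
      then obtain b where b: "b \<in> B" "dist b ((x - a) /\<^sub>R r) < 1 / 4"
        unfolding UN_iff mem_ball by blast
      have "dist (a + r *\<^sub>R b) x = r * dist b ((x - a) /\<^sub>R r)"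
      proof -
        have "a + r *\<^sub>R b - x = r *\<^sub>R (b - (x - a) /\<^sub>R r)" using r by (simp add: algebra_simps)
        then show ?thesis using r by (simp add: dist_norm)
      qed
      also have "\<dots> < r / 4" using b r by (simp add: field_simps)
      finally show "x \<in> (\<Union>a\<in>A'. ball a (r / 4))" unfolding A'_def using a b by force
    qed
    moreover have "finite A'" using A B by (simp add: A'_def)
    ultimately have "covering_number (r / 4) E \<le> card A'" by (intro covering_number_le)
    also have "\<dots> \<le> card (B \<times> A)" unfolding A'_def using A B by (intro card_image_le) simp
    finally show "covering_number (r / 4) E \<le> card B * covering_number r E"
      using A(3) by (simp add: card_cartesian_product)
  qed
qed

text \<open>
By induction over the covering balls: a point \<open>y\<close> of \<open>E\<close> in the ball about \<open>a\<close> of radius \<open>r / 2\<close> has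
that whole ball within distance \<open>r\<close>, so what is left of \<open>E\<close> outside \<open>ball y r\<close> is covered by the
remaining balls.
\<close>

lemma separated_net:
  fixes E :: "'a::metric_space set"
  assumes "finite A" "E \<subseteq> (\<Union>a\<in>A. ball a (r / 2))"
  shows "\<exists>Y. finite Y \<and> Y \<subseteq> E \<and> E \<subseteq> (\<Union>y\<in>Y. ball y r) \<and>
    (\<forall>y\<in>Y. \<forall>z\<in>Y. y \<noteq> z \<longrightarrow> r \<le> dist y z)"
  using assms
proof (induction A arbitrary: E rule: finite_induct)
  case empty
  then show ?case by auto
next
  case (insert a A)
  show ?case
  proof (cases "E \<inter> ball a (r / 2) = {}")
    case True
    then have "E \<subseteq> (\<Union>a\<in>A. ball a (r / 2))" using insert.prems by auto
    then show ?thesis by (rule insert.IH)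
  next
    case False
    then obtain y where y: "y \<in> E" "dist a y < r / 2" by auto
    have "ball a (r / 2) \<subseteq> ball y r"
    proof
      fix z
      assume "z \<in> ball a (r / 2)"
      then show "z \<in> ball y r" using y dist_triangle[of y z a] by (simp add: dist_commute)
    qed
    then have "E - ball y r \<subseteq> (\<Union>a\<in>A. ball a (r / 2))" using insert.prems by blast
    from insert.IH[OF this] obtain Y where Y: "finite Y" "Y \<subseteq> E - ball y r"
      "E - ball y r \<subseteq> (\<Union>y\<in>Y. ball y r)" "\<forall>y\<in>Y. \<forall>z\<in>Y. y \<noteq> z \<longrightarrow> r \<le> dist y z"
      by metis
    have far: "r \<le> dist y z" if "z \<in> Y" for z
      using Y(2) that by (auto simp: subset_iff not_less)
    show ?thesis
    proof (intro exI[of _ "insert y Y"] conjI ballI impI)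
      show "E \<subseteq> (\<Union>y\<in>insert y Y. ball y r)" using Y(3) by blast
      fix u v
      assume "u \<in> insert y Y" "v \<in> insert y Y" "u \<noteq> v"
      then show "r \<le> dist u v" using far[of u] far[of v] Y(4) by (metis dist_commute insert_iff)
    qed (use Y(1,2) y(1) in auto)
  qed
qed

section \<open>Least covering numbers of balls\<close>

definition min_cover :: "'a::metric_space set \<Rightarrow> real \<Rightarrow> real \<Rightarrow> real" where
  "min_cover F R r = (INF x\<in>F. real (covering_number r (ball x R \<inter> F)))"

lemma min_cover_le: "x \<in> F \<Longrightarrow> min_cover F R r \<le> real (covering_number r (ball x R \<inter> F))"
  unfolding min_cover_def by (rule cINF_lower) (auto intro: bdd_belowI2[of _ 0])

lemma le_min_cover:
  assumes "F \<noteq> {}" "\<And>x. x \<in> F \<Longrightarrow> B \<le> real (covering_number r (ball x R \<inter> F))"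
  shows "B \<le> min_cover F R r"
  unfolding min_cover_def using assms by (rule cINF_greatest)

lemma le_min_cover_iff:
  assumes "F \<noteq> {}"
  shows "B \<le> min_cover F R r \<longleftrightarrow> (\<forall>x\<in>F. B \<le> real (covering_number r (ball x R \<inter> F)))"
  using le_min_cover[OF assms] min_cover_le[of _ F R r] by (meson order_trans)

lemma min_cover_ge_1:
  fixes F :: "'a::heine_borel set"
  assumes "F \<noteq> {}" "bounded F" "0 < R" "0 < r"
  shows "1 \<le> min_cover F R r"
proof (rule le_min_cover[OF assms(1)])
  fix x
  assume "x \<in> F"
  then have "x \<in> ball x R \<inter> F" using assms by simp
  then have "ball x R \<inter> F \<noteq> {}" by blast
  then show "1 \<le> real (covering_number r (ball x R \<inter> F))"
    using covering_number_pos[of "ball x R \<inter> F" r] assms by (simp add: bounded_Int)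
qed

lemma min_cover_mono_radius:
  fixes F :: "'a::heine_borel set"
  assumes "F \<noteq> {}" "bounded F" "R' \<le> R" "0 < r"
  shows "min_cover F R' r \<le> min_cover F R r"
proof (rule le_min_cover[OF assms(1)])
  fix x
  assume x: "x \<in> F"
  have "covering_number r (ball x R' \<inter> F) \<le> covering_number r (ball x R \<inter> F)"
    using assms by (intro covering_number_mono) (auto simp: bounded_Int)
  then show "min_cover F R' r \<le> real (covering_number r (ball x R \<inter> F))"
    using min_cover_le[OF x, of R' r] by linarith
qed

text \<open>
Take a net in the ball of half the radius whose points have mutual distance at least \<open>4 * r1\<close>. The
balls of radius \<open>r1\<close> about its points stay inside the big ball, and no ball of radius \<open>r2 \<le> r1\<close> meets
two of them. So any cover of the big ball contains disjoint covers of the small ones.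
The constant \<open>M\<close> compares covers by balls of radius \<open>4 * r1\<close> and \<open>r1\<close>.
\<close>

lemma min_cover_glue:
  fixes F :: "'a::euclidean_space set"
  assumes F: "F \<noteq> {}" "bounded F" and r: "0 < r2" "r2 \<le> r1" "r1 \<le> R / 2" and "0 < M"
    and M: "\<And>(E :: 'a set) r. bounded E \<Longrightarrow> 0 < r \<Longrightarrow>
      covering_number (r / 4) E \<le> M * covering_number r E"
  shows "min_cover F (R / 2) r1 * min_cover F r1 r2 \<le> real M * min_cover F R r2"
proof -
  have pos: "0 \<le> min_cover F r1 r2" using min_cover_ge_1[OF F, of r1 r2] r by linarith
  have main: "min_cover F (R / 2) r1 * min_cover F r1 r2
      \<le> real M * real (covering_number r2 (ball x R \<inter> F))" if x: "x \<in> F" for x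
  proof -
    define E where "E = ball x (R / 2) \<inter> F"
    have bE: "bounded E" using F by (simp add: E_def bounded_Int)
    have "0 < 4 * r1 / 2" using r by linarith
    then obtain B where B: "finite B" "E \<subseteq> (\<Union>b\<in>B. ball b (4 * r1 / 2))"
      by (rule covering_number_attained[OF bE])
    obtain Y where Y: "finite Y" "Y \<subseteq> E" "E \<subseteq> (\<Union>y\<in>Y. ball y (4 * r1))"
      and sep: "\<And>y z. y \<in> Y \<Longrightarrow> z \<in> Y \<Longrightarrow> y \<noteq> z \<Longrightarrow> 4 * r1 \<le> dist y z"
      using separated_net[OF B] by blast
    have "covering_number r1 E \<le> M * covering_number (4 * r1) E"
      using M[OF bE, of "4 * r1"] r by simp
    also have "\<dots> \<le> M * card Y" using covering_number_le[OF Y(1,3)] by simp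
    finally have "real (covering_number r1 E) \<le> real M * real (card Y)"
      by (metis of_nat_le_iff of_nat_mult)
    then have cardY: "min_cover F (R / 2) r1 \<le> real M * real (card Y)"
      using min_cover_le[OF x, of "R / 2" r1] unfolding E_def by linarith
    have "bounded (ball x R \<inter> F)" using F by (simp add: bounded_Int)
    then obtain A where A: "finite A" "ball x R \<inter> F \<subseteq> (\<Union>a\<in>A. ball a r2)"
      "card A = covering_number r2 (ball x R \<inter> F)"
      using covering_number_attained r by blast
    define near where "near y = {a \<in> A. ball a r2 \<inter> ball y r1 \<noteq> {}}" for y
    have disjoint: "near y \<inter> near z = {}" if "y \<in> Y" "z \<in> Y" "y \<noteq> z" for y z
    proof (rule ccontr)
      assume "near y \<inter> near z \<noteq> {}"
      then obtain a p q where "dist a p < r2" "dist y p < r1" "dist a q < r2" "dist z q < r1"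
        by (auto simp: near_def)
      moreover have "dist y z \<le> dist y p + dist a p + dist a q + dist z q"
        using dist_triangle[of y z a] dist_triangle[of y a p] dist_triangle[of a z q]
        by (simp add: dist_commute)
      ultimately show False using sep[OF that] r by linarith
    qed
    have near_card: "min_cover F r1 r2 \<le> real (card (near y))" if y: "y \<in> Y" for y
    proof -
      have "dist x y < R / 2" "y \<in> F" using Y y by (auto simp: E_def)
      have "ball y r1 \<subseteq> ball x R"
      proof
        fix z
        assume "z \<in> ball y r1"
        then show "z \<in> ball x R"
          using dist_triangle[of x z y] \<open>dist x y < R / 2\<close> r by simp
      qed
      then have "ball y r1 \<inter> F \<subseteq> (\<Union>a\<in>near y. ball a r2)"
        using A(2) by (fastforce simp: near_def)
      moreover have "finite (near y)" using A by (simp add: near_def)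
      ultimately have "covering_number r2 (ball y r1 \<inter> F) \<le> card (near y)"
        by (intro covering_number_le)
      then show ?thesis using min_cover_le[OF \<open>y \<in> F\<close>, of r1 r2] by linarith
    qed
    have "real (card Y) * min_cover F r1 r2 \<le> (\<Sum>y\<in>Y. real (card (near y)))"
      using near_card sum_bounded_below[of Y "min_cover F r1 r2" "\<lambda>y. real (card (near y))"] by simp
    also have "\<dots> = real (card (\<Union>y\<in>Y. near y))"
      using Y A disjoint by (subst card_UN_disjoint) (auto simp: near_def)
    also have "\<dots> \<le> real (card A)" using A by (intro of_nat_mono card_mono) (auto simp: near_def)
    finally have "real M * (real (card Y) * min_cover F r1 r2) \<le> real M * real (card A)"
      by (intro mult_left_mono) auto
    moreover have "min_cover F (R / 2) r1 * min_cover F r1 r2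
        \<le> real M * real (card Y) * min_cover F r1 r2"
      using cardY pos by (rule mult_right_mono)
    ultimately show ?thesis using A(3) by (simp add: mult.assoc)
  qed
  have "min_cover F (R / 2) r1 * min_cover F r1 r2 / real M \<le> min_cover F R r2"
    using main \<open>0 < M\<close> by (intro le_min_cover[OF F(1)]) (simp add: field_simps)
  then show ?thesis using \<open>0 < M\<close> by (simp add: field_simps)
qed

lemma min_cover_growth:
  fixes F :: "'a::euclidean_space set"
  assumes F: "F \<noteq> {}" "bounded F" and r: "0 < r" and "0 < M"
    and M: "\<And>(E :: 'a set) r. bounded E \<Longrightarrow> 0 < r \<Longrightarrow>
      covering_number (r / 4) E \<le> M * covering_number r E"
  shows "min_cover F R (r / 4 ^ k) \<le> real M ^ k * min_cover F R r"
proof (induction k)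
  case (Suc k)
  have "min_cover F R (r / 4 ^ Suc k) \<le> real M * real (covering_number (r / 4 ^ k) (ball x R \<inter> F))"
    if x: "x \<in> F" for x
  proof -
    have "covering_number (r / 4 ^ k / 4) (ball x R \<inter> F) \<le> M * covering_number (r / 4 ^ k) (ball x R \<inter> F)"
      using F r by (intro M) (auto simp: bounded_Int)
    moreover have "r / 4 ^ k / 4 = r / 4 ^ Suc k" by simp
    ultimately have "real (covering_number (r / 4 ^ Suc k) (ball x R \<inter> F))
        \<le> real M * real (covering_number (r / 4 ^ k) (ball x R \<inter> F))"
      by (metis of_nat_le_iff of_nat_mult)
    then show ?thesis using min_cover_le[OF x, of R "r / 4 ^ Suc k"] by linarith
  qed
  note * = this
  have "min_cover F R (r / 4 ^ Suc k) \<le> real M * min_cover F R (r / 4 ^ k)"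
  proof -
    have "min_cover F R (r / 4 ^ Suc k) / real M \<le> min_cover F R (r / 4 ^ k)"
    proof (rule le_min_cover[OF F(1)])
      fix x
      assume "x \<in> F"
      then show "min_cover F R (r / 4 ^ Suc k) / real M \<le> real (covering_number (r / 4 ^ k) (ball x R \<inter> F))"
        using *[of x] \<open>0 < M\<close> by (simp add: pos_divide_le_eq mult.commute)
    qed
    then show ?thesis using \<open>0 < M\<close> by (simp add: pos_divide_le_eq mult.commute)
  qed
  also have "\<dots> \<le> real M * (real M ^ k * min_cover F R r)"
    using Suc.IH by (intro mult_left_mono) auto
  finally show ?case by (simp add: mult.assoc)
qed simp

section \<open>The covering profile\<close>

definition profile :: "'a::metric_space set \<Rightarrow> real \<Rightarrow> real \<Rightarrow> real" where
  "profile F t u = ln (min_cover F (exp (- t)) (exp (- (t + u))))"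

text \<open>
The shift property is monotonicity in the radius of the big ball. For the growth bound, \<open>exp h\<close> is
rounded up to a power \<open>4 ^ k\<close>: quartering the small radius \<open>k\<close> times multiplies the covering number
by at most \<open>M ^ k\<close>, which is exponential in \<open>h\<close>.
\<close>

lemma scale_profile_profile:
  fixes F :: "'a::euclidean_space set"
  assumes F: "F \<noteq> {}" "bounded F"
  shows "\<exists>K D. scale_profile (profile F) (ln 2) K D"
proof -
  obtain M where M1: "1 \<le> M"
    and M: "\<And>(E :: 'a set) r. bounded E \<Longrightarrow> 0 < r \<Longrightarrow>
      covering_number (r / 4) E \<le> M * covering_number r E"
    using covering_number_quarter by metis
  have one: "1 \<le> min_cover F (exp a) (exp b)" for a b
    using min_cover_ge_1[OF F] by simp
  then have pos: "0 < min_cover F (exp a) (exp b)" for a b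
    by (metis less_le_trans zero_less_one)
  have "scale_profile (profile F) (ln 2) (ln (real M)) (ln (real M) / ln 4)"
  proof
    show "0 \<le> ln (2 :: real)" "0 \<le> ln (real M)" "0 \<le> ln (real M) / ln 4"
      using M1 by auto
    fix t u :: real
    assume t: "0 < t"
    show "0 \<le> profile F t u" unfolding profile_def using one by (simp add: ln_ge_zero)
    show "profile F (t + h) (u - h) \<le> profile F t u" if "0 \<le> h" for h
      unfolding profile_def using pos that
      by (intro ln_mono) (simp_all add: min_cover_mono_radius[OF F])
    show "profile F (t + ln 2) v + profile F (t + ln 2 + v) w - ln (real M)
        \<le> profile F t (ln 2 + v + w)" if vw: "0 \<le> v" "0 \<le> w" for v w
    proof -
      let ?R = "exp (- t)" and ?r1 = "exp (- (t + ln 2 + v))" and ?r2 = "exp (- (t + ln 2 + v + w))"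
      have half: "exp (- (t + ln 2)) = ?R / 2" by (simp add: exp_diff exp_minus field_simps)
      have "?r1 \<le> exp (- (t + ln 2))" using vw by simp
      then have r1: "?r1 \<le> ?R / 2" using half by (rule order_trans[OF _ eq_refl])
      have r2: "?r2 \<le> ?r1" using vw by simp
      have pos': "0 < min_cover F (?R / 2) ?r1" unfolding half[symmetric] by (rule pos)
      have "min_cover F (?R / 2) ?r1 * min_cover F ?r1 ?r2 \<le> real M * min_cover F ?R ?r2"
        using min_cover_glue[OF F exp_gt_zero r2 r1 _ M] M1 by simp
      then have "ln (min_cover F (?R / 2) ?r1 * min_cover F ?r1 ?r2) \<le> ln (real M * min_cover F ?R ?r2)"
        by (rule ln_mono[OF _ mult_pos_pos[OF pos' pos]])
      also have "\<dots> = ln (real M) + profile F t (ln 2 + v + w)"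
        unfolding profile_def add.assoc[symmetric] using M1 by (intro ln_mult_pos pos) simp
      also have "ln (min_cover F (?R / 2) ?r1 * min_cover F ?r1 ?r2)
          = profile F (t + ln 2) v + profile F (t + ln 2 + v) w"
        unfolding profile_def half by (intro ln_mult_pos pos pos')
      finally show ?thesis by linarith
    qed
    show "profile F t (u + h) \<le> profile F t u + ln (real M) / ln 4 * h + ln (real M)"
      if h: "0 \<le> h" for h
    proof -
      define k where "k = nat \<lceil>h / ln 4\<rceil>"
      have k: "h / ln 4 \<le> real k" "real k \<le> h / ln 4 + 1"
        using h by (auto simp: k_def)
      have "h \<le> real k * ln 4" using k by (simp add: field_simps)
      then have "exp h \<le> 4 ^ k" by (metis exp_le_cancel_iff exp_of_nat_mult exp_ln zero_less_numeral)
      let ?R = "exp (- t)" and ?r = "exp (- (t + u))"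
      have small: "?r / 4 ^ k \<le> exp (- (t + (u + h)))"
      proof -
        have "exp (- (t + (u + h))) = ?r / exp h" by (simp flip: exp_diff)
        then show ?thesis using \<open>exp h \<le> 4 ^ k\<close> by (simp add: frac_le)
      qed
      have "min_cover F ?R (exp (- (t + (u + h)))) \<le> min_cover F ?R (?r / 4 ^ k)"
      proof (rule le_min_cover[OF F(1)])
        fix x
        assume x: "x \<in> F"
        have "covering_number (exp (- (t + (u + h)))) (ball x ?R \<inter> F)
            \<le> covering_number (?r / 4 ^ k) (ball x ?R \<inter> F)"
          using F(2) by (intro covering_number_mono[OF _ _ _ small]) (simp_all add: bounded_Int)
        then show "min_cover F ?R (exp (- (t + (u + h)))) \<le> real (covering_number (?r / 4 ^ k) (ball x ?R \<inter> F))"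
          using min_cover_le[OF x, of ?R "exp (- (t + (u + h)))"] by linarith
      qed
      also have "\<dots> \<le> real M ^ k * min_cover F ?R ?r"
        using min_cover_growth[OF F exp_gt_zero _ M] M1 by simp
      finally have "profile F t (u + h) \<le> ln (real M ^ k * min_cover F ?R ?r)"
        unfolding profile_def using pos M1 by (subst ln_le_cancel_iff) auto
      also have "\<dots> = real k * ln (real M) + profile F t u"
        unfolding profile_def using pos M1 by (simp add: ln_mult_pos ln_realpow)
      also have "real k * ln (real M) \<le> (h / ln 4 + 1) * ln (real M)"
        using k M1 by (intro mult_right_mono) auto
      finally show ?thesis by (simp add: algebra_simps)
    qed
  qed
  then show ?thesis by blast
qed

section \<open>Dimensions as suprema of exponents\<close>

text \<open>
The four dimensions are suprema over bounds of this shape, each with its own relation \<open>Q\<close> between the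
two radii.
\<close>

lemma cover_bound_iff_profile_bound:
  fixes F :: "'a::heine_borel set"
  assumes F: "F \<noteq> {}" "bounded F"
  shows "(\<exists>C>0. \<forall>r R. 0 < r \<and> r < R \<and> R < 1 \<and> Q R r \<longrightarrow> C * (R / r) powr s \<le> min_cover F R r)
    \<longleftrightarrow> (\<exists>c. \<forall>t>0. \<forall>u>0. Q (exp (- t)) (exp (- (t + u))) \<longrightarrow> s * u - c \<le> profile F t u)"
    (is "?A \<longleftrightarrow> ?B")
proof
  assume ?A
  then obtain C where C: "0 < C" "\<And>r R. 0 < r \<Longrightarrow> r < R \<Longrightarrow> R < 1 \<Longrightarrow> Q R r \<Longrightarrow>
      C * (R / r) powr s \<le> min_cover F R r"
    by blast
  show ?B
  proof (intro exI[of _ "- ln C"] allI impI)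
    fix t u :: real
    assume t: "0 < t" "0 < u" "Q (exp (- t)) (exp (- (t + u)))"
    have "exp (- t) / exp (- (t + u)) = exp u" by (simp flip: exp_diff)
    then have "C * exp (s * u) \<le> min_cover F (exp (- t)) (exp (- (t + u)))"
      using C(2)[of "exp (- (t + u))" "exp (- t)"] t by (simp add: exp_powr_real mult.commute)
    then have "ln (C * exp (s * u)) \<le> profile F t u"
      unfolding profile_def using C(1) by (intro ln_mono) simp_all
    then show "s * u - - ln C \<le> profile F t u" using C(1) by (simp add: ln_mult_pos)
  qed
next
  assume ?B
  then obtain c where c: "\<And>t u. 0 < t \<Longrightarrow> 0 < u \<Longrightarrow> Q (exp (- t)) (exp (- (t + u))) \<Longrightarrow>
      s * u - c \<le> profile F t u"
    by blast
  have "exp (- c) * (R / r) powr s \<le> min_cover F R r"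
    if r: "0 < r" "r < R" "R < 1" "Q R r" for r R
  proof -
    define t u where "t = - ln R" and "u = ln (R / r)"
    have R: "exp (- t) = R" "exp (- (t + u)) = r" "0 < t" "0 < u"
      using r by (simp_all add: t_def u_def ln_div)
    have "s * u - c \<le> ln (min_cover F R r)"
      using c[OF R(3,4)] r(4) unfolding profile_def R by simp
    then have "exp (s * u - c) \<le> min_cover F R r"
      using min_cover_ge_1[OF F, of R r] r by (subst (asm) ln_ge_iff) auto
    moreover have "exp (s * u - c) = exp (- c) * (R / r) powr s"
      using r by (simp add: powr_def u_def exp_diff exp_minus field_simps)
    ultimately show ?thesis by simp
  qed
  then show ?A by (intro exI[of _ "exp (- c)"]) auto
qed

lemma lower_dim_eq_Sup_exponents:
  fixes F :: "'a::heine_borel set"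
  assumes F: "F \<noteq> {}" "bounded F"
  shows "lower_dim F = Sup (ereal ` {s. s \<ge> 0 \<and> lower_exponent (profile F) s})"
  using cover_bound_iff_profile_bound[OF F, of "\<lambda>_ _. True"]
  unfolding lower_dim_def lower_exponent_def le_min_cover_iff[OF F(1)] by simp

lemma lower_spectrum_eq_Sup_exponents:
  fixes F :: "'a::heine_borel set"
  assumes F: "F \<noteq> {}" "bounded F" and \<theta>: "0 < \<theta>" "\<theta> < 1"
  shows "lower_spectrum F \<theta> =
    Sup (ereal ` {s. s \<ge> 0 \<and> phi_exponent (profile F) (\<lambda>t. (1 / \<theta> - 1) * t) s})"
proof -
  have l: "0 < 1 / \<theta> - 1" using \<theta> by (simp add: field_simps)
  have small: "R powr (1 / \<theta>) < R" if "0 < R" "R < 1" for R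
    using powr_less_mono'[of R 1 "1 / \<theta>"] that l by simp
  have Q: "exp (- (t + u)) = exp (- t) powr (1 / \<theta>) \<longleftrightarrow> u = (1 / \<theta> - 1) * t" for t u
    by (auto simp: exp_powr_real algebra_simps)
  have "(\<exists>C>0. \<forall>R. 0 < R \<and> R < 1 \<longrightarrow> (\<forall>x\<in>F. C * (R / R powr (1 / \<theta>)) powr s
        \<le> real (covering_number (R powr (1 / \<theta>)) (ball x R \<inter> F))))
      \<longleftrightarrow> (\<exists>C>0. \<forall>r R. 0 < r \<and> r < R \<and> R < 1 \<and> r = R powr (1 / \<theta>) \<longrightarrow>
        C * (R / r) powr s \<le> min_cover F R r)" for s
    unfolding le_min_cover_iff[OF F(1)] using small
    by (auto intro!: ex_cong1 intro: le_less_trans[OF powr_ge_zero])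
  also have "\<dots> s \<longleftrightarrow> phi_exponent (profile F) (\<lambda>t. (1 / \<theta> - 1) * t) s" for s
    unfolding cover_bound_iff_profile_bound[OF F] Q phi_exponent_def
    using l by simp
  finally show ?thesis unfolding lower_spectrum_def by simp
qed

context
  fixes F :: "'a::heine_borel set" and \<psi> \<phi> :: "real \<Rightarrow> real"
  assumes F: "F \<noteq> {}" "bounded F"
    and pos: "\<And>t. 0 < t \<Longrightarrow> 0 < \<psi> t"
    and \<phi>: "\<And>t. 0 < t \<Longrightarrow> \<phi> (exp (- t)) * t = \<psi> t"
begin

lemma powr_phi: "0 < t \<Longrightarrow> exp (- t) powr (1 + \<phi> (exp (- t))) = exp (- (t + \<psi> t))"
  using \<phi>[of t] by (simp add: exp_powr_real algebra_simps)

lemma powr_phi_less: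
  assumes "0 < R" "R < 1"
  shows "R powr (1 + \<phi> R) < R"
proof -
  have "R powr (1 + \<phi> R) = exp (ln R - \<psi> (- ln R))"
    using powr_phi[of "- ln R"] assms by simp
  also have "\<dots> < exp (ln R)" using pos[of "- ln R"] assms by (subst exp_less_cancel_iff) simp
  finally show ?thesis using assms by simp
qed

lemma phi_lower_dim_eq_Sup_exponents:
  "phi_lower_dim \<phi> F = Sup (ereal ` {s. s \<ge> 0 \<and> phi_exponent (profile F) \<psi> s})"
proof -
  have ratio: "(R / R powr (1 + \<phi> R)) powr s = R powr (- (\<phi> R * s))" if "0 < R" for R s
  proof -
    have "R / R powr (1 + \<phi> R) = R powr (- \<phi> R)"
      using powr_diff[of R 1 "1 + \<phi> R"] that by simp
    then show ?thesis by (simp add: powr_powr)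
  qed
  have "(\<exists>C>0. \<forall>R. 0 < R \<and> R < 1 \<longrightarrow>
        C * R powr (- (\<phi> R * s)) \<le> min_cover F R (R powr (1 + \<phi> R)))
      \<longleftrightarrow> (\<exists>C>0. \<forall>r R. 0 < r \<and> r < R \<and> R < 1 \<and> r = R powr (1 + \<phi> R) \<longrightarrow>
        C * (R / r) powr s \<le> min_cover F R r)" for s
    using powr_phi_less
    by (auto intro!: ex_cong1 intro: le_less_trans[OF powr_ge_zero] simp: ratio)
  also have "\<dots> s \<longleftrightarrow> phi_exponent (profile F) \<psi> s" for s
    unfolding cover_bound_iff_profile_bound[OF F] phi_exponent_def
    using pos by (auto simp: powr_phi intro!: ex_cong1)
  finally show ?thesis unfolding phi_lower_dim_def min_cover_def by simp
qed

lemma quasi_phi_lower_dim_eq_Sup_exponents: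
  "quasi_phi_lower_dim \<phi> F = Sup (ereal ` {s. s \<ge> 0 \<and> quasi_exponent (profile F) \<psi> s})"
proof -
  have "(\<exists>C>0. \<forall>r R. 0 < r \<and> r \<le> R powr (1 + \<phi> R) \<and> R powr (1 + \<phi> R) < R \<and> R < 1 \<longrightarrow>
        C * (R / r) powr s \<le> min_cover F R r)
      \<longleftrightarrow> (\<exists>C>0. \<forall>r R. 0 < r \<and> r < R \<and> R < 1 \<and> r \<le> R powr (1 + \<phi> R) \<longrightarrow>
        C * (R / r) powr s \<le> min_cover F R r)" for s
    using powr_phi_less by (intro ex_cong1) (meson le_less_trans less_trans)
  also have "\<dots> s \<longleftrightarrow> quasi_exponent (profile F) \<psi> s" for s
  proof -
    have "0 < u \<and> exp (- (t + u)) \<le> exp (- t) powr (1 + \<phi> (exp (- t))) \<longleftrightarrow> \<psi> t \<le> u"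
      if "0 < t" for t u
      using pos[OF that] powr_phi[OF that] by auto
    then show ?thesis
      unfolding cover_bound_iff_profile_bound[OF F] quasi_exponent_def by (meson)
  qed
  finally show ?thesis unfolding quasi_phi_lower_dim_def min_cover_def by simp
qed

end

lemma Sup_exponents_eq:
  assumes s: "0 \<le> s" and zero: "E 0"
    and below: "\<And>a. 0 \<le> a \<Longrightarrow> a < s \<Longrightarrow> E a" and above: "\<And>a. s < a \<Longrightarrow> \<not> E a"
  shows "Sup (ereal ` {a. a \<ge> 0 \<and> E a}) = ereal s"
proof (rule antisym)
  show "Sup (ereal ` {a. a \<ge> 0 \<and> E a}) \<le> ereal s"
    by (rule Sup_least) (use above in \<open>force simp flip: not_less\<close>)
  show "ereal s \<le> Sup (ereal ` {a. a \<ge> 0 \<and> E a})"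
  proof (rule dense_le)
    fix x
    assume "x < ereal s"
    then obtain a where a: "x < ereal a" "a < s" using ereal_dense2 by force
    have "E (max 0 a)" using zero below[of a] a by (simp add: max_def)
    then have "ereal (max 0 a) \<le> Sup (ereal ` {a. a \<ge> 0 \<and> E a})"
      by (intro Sup_upper imageI) simp
    moreover have "ereal a \<le> ereal (max 0 a)" by simp
    ultimately show "x \<le> Sup (ereal ` {a. a \<ge> 0 \<and> E a})" using a(1) by (meson less_imp_le order_trans)
  qed
qed

section \<open>The quasi-lower dimension and far exponents\<close>

lemma phi_exponent_mono:
  assumes "phi_exponent g \<psi> a" "b \<le> a" "\<And>t. 0 < t \<Longrightarrow> 0 \<le> \<psi> t"
  shows "phi_exponent g \<psi> b"
proof -
  obtain c where c: "\<And>t. 0 < t \<Longrightarrow> a * \<psi> t - c \<le> g t (\<psi> t)"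
    using assms unfolding phi_exponent_def by blast
  have "b * \<psi> t - c \<le> g t (\<psi> t)" if "0 < t" for t
    using c[OF that] mult_right_mono[OF assms(2) assms(3)[OF that]] by linarith
  then show ?thesis unfolding phi_exponent_def by blast
qed

context
  fixes F :: "'a::euclidean_space set"
  assumes F: "F \<noteq> {}" "bounded F"
begin

lemma profile_nonneg: "0 \<le> profile F t u"
  unfolding profile_def using min_cover_ge_1[OF F] by (simp add: ln_ge_zero)

lemma less_lower_spectrum:
  assumes "0 < \<theta>" "\<theta> < 1" "ereal a < lower_spectrum F \<theta>"
  shows "phi_exponent (profile F) (\<lambda>t. (1 / \<theta> - 1) * t) a"
proof -
  obtain b where "a < b" "phi_exponent (profile F) (\<lambda>t. (1 / \<theta> - 1) * t) b"
    using assms unfolding lower_spectrum_eq_Sup_exponents[OF F assms(1,2)] less_Sup_iff by auto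
  then show ?thesis using assms by (auto intro!: phi_exponent_mono[of _ _ b])
qed

lemma le_lower_spectrum:
  assumes "0 < \<theta>" "\<theta> < 1" "0 \<le> a" "far_exponent (profile F) a"
  shows "ereal a \<le> lower_spectrum F \<theta>"
proof -
  obtain K D where "scale_profile (profile F) (ln 2) K D" using scale_profile_profile[OF F] by blast
  then interpret scale_profile "profile F" "ln 2" K D .
  have "phi_exponent (profile F) (\<lambda>t. (1 / \<theta> - 1) * t) a"
    using assms by (intro phi_exponent_linear_if_far) (auto simp: field_simps)
  then show ?thesis
    unfolding lower_spectrum_eq_Sup_exponents[OF F assms(1,2)]
    using assms by (intro Sup_upper) auto
qed

text \<open>
The spectrum at \<open>\<theta>\<close> concerns \<open>u = (1 / \<theta> - 1) * t\<close>, which for \<open>\<theta>\<close> near \<open>1\<close> is a short step.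
\<close>

lemma far_exponent_if_frequently:
  assumes less: "a < a'" and freq: "\<exists>\<^sub>F \<theta> in at_left 1. ereal a' < lower_spectrum F \<theta>"
  shows "far_exponent (profile F) a"
proof -
  obtain K D where "scale_profile (profile F) (ln 2) K D" using scale_profile_profile[OF F] by blast
  then interpret scale_profile "profile F" "ln 2" K D .
  show ?thesis
  proof (rule far_exponent_if_linear[OF less])
    fix \<epsilon> :: real
    assume \<epsilon>: "0 < \<epsilon>"
    have "eventually (\<lambda>\<theta>. \<theta> \<in> {1 / (1 + \<epsilon>)<..<1}) (at_left (1 :: real))"
      using \<epsilon> by (intro eventually_at_left_real) simp
    with freq have "\<exists>\<^sub>F \<theta> in at_left 1. ereal a' < lower_spectrum F \<theta> \<and> \<theta> \<in> {1 / (1 + \<epsilon>)<..<1}"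
      by (rule frequently_eventually_frequently)
    then obtain \<theta> where \<theta>: "ereal a' < lower_spectrum F \<theta>" "1 / (1 + \<epsilon>) < \<theta>" "\<theta> < 1"
      by (auto dest: frequently_ex)
    have "0 < \<theta>" using \<theta>(2) \<epsilon> by (meson add_pos_pos divide_pos_pos less_trans zero_less_one)
    show "\<exists>l>0. l \<le> \<epsilon> \<and> phi_exponent (profile F) (\<lambda>t. l * t) a'"
    proof (intro exI conjI)
      show "0 < 1 / \<theta> - 1" "1 / \<theta> - 1 \<le> \<epsilon>" using \<theta> \<open>0 < \<theta>\<close> \<epsilon> by (auto simp: field_simps)
      show "phi_exponent (profile F) (\<lambda>t. (1 / \<theta> - 1) * t) a'"
        using less_lower_spectrum \<theta> \<open>0 < \<theta>\<close> by blast
    qed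
  qed
qed

text \<open>
The limit that defines the quasi-lower dimension exists: a value above the infimum that is taken by
the spectrum for \<open>\<theta>\<close> arbitrarily close to \<open>1\<close> would give a far exponent above some value of the
spectrum, whereas a far exponent is a lower bound for the whole spectrum.
\<close>

lemma quasi_lower_dim_eq_INF: "quasi_lower_dim F = (INF \<theta>\<in>{0<..<1}. lower_spectrum F \<theta>)"
proof -
  let ?L = "INF \<theta>\<in>{0<..<1}. lower_spectrum F \<theta>"
  have zero: "0 \<le> lower_spectrum F \<theta>" if "0 < \<theta>" "\<theta> < 1" for \<theta>
  proof -
    have "far_exponent (profile F) 0"
      unfolding far_exponent_def using profile_nonneg by auto
    then show ?thesis using le_lower_spectrum[OF that, of 0] by (simp add: zero_ereal_def)
  qed
  have "(lower_spectrum F \<longlongrightarrow> ?L) (at_left 1)"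
  proof (rule order_tendstoI)
    fix x
    assume x: "x < ?L"
    have "eventually (\<lambda>\<theta>. \<theta> \<in> {0<..<1}) (at_left (1 :: real))"
      by (intro eventually_at_left_real) simp
    then show "\<forall>\<^sub>F \<theta> in at_left 1. x < lower_spectrum F \<theta>"
      by eventually_elim (use x INF_lower[of _ "{0<..<1}" "lower_spectrum F"] in \<open>blast intro: less_le_trans\<close>)
  next
    fix x
    assume x: "?L < x"
    then obtain \<theta> where \<theta>: "0 < \<theta>" "\<theta> < 1" "lower_spectrum F \<theta> < x"
      by (auto simp: INF_less_iff)
    obtain a where a: "lower_spectrum F \<theta> < ereal a" "ereal a < x"
      using ereal_dense2[OF \<theta>(3)] by blast
    obtain a' where a': "a < a'" "ereal a' < x"
      using ereal_dense2[OF a(2)] by auto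
    have "0 \<le> a" using zero[OF \<theta>(1,2)] a(1) by (simp add: zero_ereal_def) (meson ereal_less_eq(3) le_less_trans less_imp_le)
    show "\<forall>\<^sub>F \<theta> in at_left 1. lower_spectrum F \<theta> < x"
    proof (rule ccontr)
      assume "\<not> ?thesis"
      then have "\<exists>\<^sub>F \<theta> in at_left 1. x \<le> lower_spectrum F \<theta>"
        by (simp add: frequently_def not_le)
      then have "\<exists>\<^sub>F \<theta> in at_left 1. ereal a' < lower_spectrum F \<theta>"
        by (rule frequently_elim1) (use a' in \<open>auto intro: less_le_trans\<close>)
      then have "far_exponent (profile F) a" using far_exponent_if_frequently a' by blast
      then have "ereal a \<le> lower_spectrum F \<theta>" using le_lower_spectrum \<theta> \<open>0 \<le> a\<close> by blast
      then show False using a(1) by simp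
    qed
  qed
  then show ?thesis unfolding quasi_lower_dim_def by (intro tendsto_Lim) simp_all
qed

lemma far_exponent_if_less_quasi_lower_dim:
  assumes "ereal a < quasi_lower_dim F"
  shows "far_exponent (profile F) a"
proof -
  obtain a' where a': "a < a'" "ereal a' < quasi_lower_dim F"
    using ereal_dense2[OF assms] by auto
  have "eventually (\<lambda>\<theta>. \<theta> \<in> {0<..<1}) (at_left (1 :: real))"
    by (intro eventually_at_left_real) simp
  then have "\<forall>\<^sub>F \<theta> in at_left 1. ereal a' < lower_spectrum F \<theta>"
    by eventually_elim
      (use a'(2) INF_lower[of _ "{0<..<1}" "lower_spectrum F"] in
        \<open>auto simp: quasi_lower_dim_eq_INF intro: less_le_trans\<close>)
  then have "\<exists>\<^sub>F \<theta> in at_left 1. ereal a' < lower_spectrum F \<theta>"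
    by (rule eventually_frequently[rotated]) simp
  then show ?thesis using far_exponent_if_frequently a' by blast
qed

end

section \<open>Dimension functions\<close>

lemma dimension_function_if_admissible:
  assumes adm: "admissible \<psi>"
  defines "\<phi> \<equiv> \<lambda>R. \<psi> (- ln R) / (- ln R)"
  shows "dimension_function \<phi>" and "\<And>R. R \<in> {0<..<1} \<Longrightarrow> \<phi> R \<in> {0..1}"
proof -
  have pos: "0 < \<psi> t" "\<psi> t \<le> t" if "0 < t" for t using adm that unfolding admissible_def by auto
  have mono: "\<psi> t \<le> \<psi> t'" "t * \<psi> t' \<le> t' * \<psi> t" if "0 < t" "t \<le> t'" for t t'
    using adm that unfolding admissible_def by auto
  have lim: "filterlim \<psi> at_top at_top" using adm unfolding admissible_def by blast
  have scale: "\<phi> R * ln (1 / R) = \<psi> (- ln R)" if "0 < R" "R < 1" for R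
    using that by (simp add: \<phi>_def ln_div)
  show range: "\<phi> R \<in> {0..1}" if "R \<in> {0<..<1}" for R
    using pos[of "- ln R"] that by (simp add: \<phi>_def divide_nonneg_neg field_simps)
  show "dimension_function \<phi>"
    unfolding dimension_function_def
  proof (intro conjI ballI)
    show "0 < \<phi> R" if "R \<in> {0<..<1}" for R
      using pos[of "- ln R"] that unfolding \<phi>_def by (intro divide_pos_pos) auto
    show "mono_on {0<..<1} \<phi>"
    proof (rule mono_onI)
      fix R S :: real
      assume R: "R \<in> {0<..<1}" "S \<in> {0<..<1}" "R \<le> S"
      have "(- ln S) * \<psi> (- ln R) \<le> (- ln R) * \<psi> (- ln S)" using R by (intro mono) auto
      then show "\<phi> R \<le> \<phi> S"
        unfolding \<phi>_def using R by (subst divide_le_eq, simp, simp add: field_simps)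
    qed
    show "antimono_on {0<..<1} (\<lambda>R. \<phi> R * ln (1 / R))"
      by (rule monotone_onI) (use scale mono(1) in auto)
    have "filterlim (\<lambda>R :: real. - ln R) at_top (at_right 0)"
      using ln_at_0 by (simp add: filterlim_uminus_at_bot)
    then have "filterlim (\<lambda>R. \<psi> (- ln R)) at_top (at_right 0)" by (rule filterlim_compose[OF lim])
    moreover have "eventually (\<lambda>R. R \<in> {0<..<1}) (at_right (0 :: real))"
      by (intro eventually_at_right_real) simp
    then have "\<forall>\<^sub>F R in at_right 0. \<phi> R * ln (1 / R) = \<psi> (- ln R)"
      by eventually_elim (use scale in auto)
    ultimately show "filterlim (\<lambda>R. \<phi> R * ln (1 / R)) at_top (at_right 0)"
      by (simp cong: filterlim_cong)
  qed
qed

theorem theorem3: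
  fixes F :: "(real ^ 'n) set" and s :: real
  assumes "F \<noteq> {}" and "bounded F"
    and "ereal s \<in> {lower_dim F..quasi_lower_dim F}"
  shows "\<exists>\<phi>. dimension_function \<phi> \<and>
           \<phi> \<in> {0<..<1} \<rightarrow> {0..real CARD('n)} \<and>
           phi_lower_dim \<phi> F = ereal s \<and>
           quasi_phi_lower_dim \<phi> F = ereal s"
proof -
  note F = assms(1,2)
  obtain K D where "scale_profile (profile F) (ln 2) K D" using scale_profile_profile[OF F] by blast
  then interpret scale_profile "profile F" "ln 2" K D .
  have lower: "a \<le> s" if "0 \<le> a" "lower_exponent (profile F) a" for a
  proof -
    have "ereal a \<le> lower_dim F"
      unfolding lower_dim_eq_Sup_exponents[OF F] using that by (intro Sup_upper) auto
    also have "\<dots> \<le> ereal s" using assms(3) by simp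
    finally show ?thesis by simp
  qed
  have "lower_exponent (profile F) 0"
    unfolding lower_exponent_def using profile_nonneg[OF F] by (intro exI[of _ 0]) auto
  then have s: "0 \<le> s" using lower[of 0] by simp
  have far: "far_exponent (profile F) a" if "a < s" for a
    using that assms(3) less_le_trans[of "ereal a" "ereal s" "quasi_lower_dim F"]
    by (intro far_exponent_if_less_quasi_lower_dim[OF F]) simp
  have "\<not> lower_exponent (profile F) a" if "s < a" for a using lower[of a] that s by auto
  then obtain \<psi> where \<psi>: "admissible \<psi>"
    and quasi: "\<And>a. 0 \<le> a \<Longrightarrow> a < s \<Longrightarrow> quasi_exponent (profile F) \<psi> a"
    and phi: "\<And>a. s < a \<Longrightarrow> \<not> phi_exponent (profile F) \<psi> a"
    using exists_admissible[OF s far] by blast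
  have pos: "0 < \<psi> t" if "0 < t" for t using \<psi> that unfolding admissible_def by auto
  define \<phi> where "\<phi> R = \<psi> (- ln R) / (- ln R)" for R
  have \<phi>: "\<phi> (exp (- t)) * t = \<psi> t" if "0 < t" for t using that by (simp add: \<phi>_def)
  have phi_if_quasi: "phi_exponent (profile F) \<psi> a" if "quasi_exponent (profile F) \<psi> a" for a
    using that unfolding quasi_exponent_def phi_exponent_def by blast
  have zero: "quasi_exponent (profile F) \<psi> 0"
    unfolding quasi_exponent_def using profile_nonneg[OF F] by (intro exI[of _ 0]) auto
  have "phi_lower_dim \<phi> F = ereal s"
  proof -
    have "phi_lower_dim \<phi> F = Sup (ereal ` {a. a \<ge> 0 \<and> phi_exponent (profile F) \<psi> a})"
      by (rule phi_lower_dim_eq_Sup_exponents[OF F]) (use pos \<phi> in auto)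
    also have "\<dots> = ereal s"
      using s zero quasi phi phi_if_quasi by (intro Sup_exponents_eq) blast+
    finally show ?thesis .
  qed
  moreover have "quasi_phi_lower_dim \<phi> F = ereal s"
  proof -
    have "quasi_phi_lower_dim \<phi> F = Sup (ereal ` {a. a \<ge> 0 \<and> quasi_exponent (profile F) \<psi> a})"
      by (rule quasi_phi_lower_dim_eq_Sup_exponents[OF F]) (use pos \<phi> in auto)
    also have "\<dots> = ereal s"
      using s zero quasi phi phi_if_quasi by (intro Sup_exponents_eq) blast+
    finally show ?thesis .
  qed
  moreover have "dimension_function \<phi>" "\<And>R. R \<in> {0<..<1} \<Longrightarrow> \<phi> R \<in> {0..1}"
    using dimension_function_if_admissible[OF \<psi>] unfolding \<phi>_def by auto
  moreover have "1 \<le> real CARD('n)" by (simp add: Suc_leI)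
  ultimately show ?thesis by (intro exI[of _ \<phi>]) (fastforce intro: order_trans)
qed

end
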